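(* Let $m$ be an odd prime, let $\alpha$ and $\beta$ be integers with $\alpha \geq 1$ and $\beta \geq 2$, and let $k$ be an integer with $1 \leq k \leq m-1$. Then the group \begin{align*} \langle \sigma_1, \sigma_2 \mid\ & \sigma_1^{2m^{\beta}} = \sigma_2^{m^{\beta}} = (\sigma_1 \sigma_2)^2 = 1;\ \sigma_2^{-1} \sigma_1 = \sigma_1^{3+k(m+1)m^{\beta-1}} \sigma_2^{1+km^{\beta-1}};\\ & \sigma_2 \sigma_1^{-1} = \sigma_1^{-3+k(m+1)m^{\beta-1}} \sigma_2^{-1+km^{\beta-1}};\ \sigma_1^{2m} \sigma_2 = \sigma_2 \sigma_1^{2m} \rangle \end{align*} is the automorphism group of a tight chiral polyhedron of type $\{2 m^{\beta}, m^{\beta}\}$. If $\beta > \alpha$, then the group \begin{align*} \langle \sigma_1, \sigma_2 \mid\ & \sigma_1^{2m^{\alpha}} = \sigma_2^{m^{\beta}} = (\sigma_1 \sigma_2)^2 = 1;\ \sigma_2^{-1} \sigma_1 = \sigma_1^3 \sigma_2^{1+km^{\beta-1}};\\ & \sigma_2 \sigma_1^{-1} = \sigma_1^{-3} \sigma_2^{-1+km^{\beta-1}};\ \sigma_1^{2m}\sigma_2 = \sigma_2 \sigma_1^{2m} \rangle \end{align*} is the automorphism group of a tight chiral polyhedron of type $\{2 m^{\alpha}, m^{\beta}\}$.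
   Context: An (abstract) polyhedron is a partially ordered set whose elements have rank $0$, $1$, $2$ (vertices, edges, faces), incidence meaning comparability, such that every edge is incident to exactly two vertices and two faces, whenever a vertex is incident to a face exactly two edges are incident to both, the incidence graph is connected, and for each vertex or face the subgraph of the incidence graph induced on its neighbours is connected. A flag is a mutually incident (vertex, edge, face) triple; $\Phi^i$ is the flag differing from $\Phi$ exactly in its rank-$i$ element. Type $\{p,q\}$: faces are incident to $p$ edges and vertices to $q$ edges. The polyhedron is chiral if its flags split into two classes with $\Phi,\Phi^i$ always in different classes and the automorphism group transitive on each class but not on all flags; then, fixing a base flag $\Phi$, the automorphism group is generated by $\sigma_1:\Phi\mapsto(\Phi^1)^0$ and $\sigma_2:\Phi\mapsto(\Phi^2)^1$. A group $\langle\sigma_1,\sigma_2\rangle$ "is the automorphism group of" such a polyhedron if there is an isomorphism onto it sending the generators $\sigma_1,\sigma_2$ to these distinguished generators. A polyhedron of type $\{p,q\}$ is tight if it has exactly $2pq$ flags. *)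

theory Defs
  imports "HOL-Computational_Algebra.Primes" "HOL-Algebra.Bij"
begin

text \<open>Group presentations. The letter \<open>(g, True)\<close> stands for the generator \<open>g\<close> and
  \<open>(g, False)\<close> for its formal inverse; a relation \<open>u = v\<close> is the pair \<open>(u, v)\<close>.\<close>

type_synonym 'g gword = "('g \<times> bool) list"

definition gword_inv :: "'g gword \<Rightarrow> 'g gword" where
  "gword_inv w = rev (map (\<lambda>(g, e). (g, \<not> e)) w)"

definition gword_pow :: "'g gword \<Rightarrow> int \<Rightarrow> 'g gword" where
  "gword_pow w z = (if 0 \<le> z then concat (replicate (nat z) w)
                    else concat (replicate (nat (- z)) (gword_inv w)))"

inductive pres_eq :: "('g gword \<times> 'g gword) set \<Rightarrow> 'g gword \<Rightarrow> 'g gword \<Rightarrow> bool"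
  for R where
  pres_refl: "pres_eq R u u"
| pres_sym: "pres_eq R u v \<Longrightarrow> pres_eq R v u"
| pres_trans: "pres_eq R u v \<Longrightarrow> pres_eq R v w \<Longrightarrow> pres_eq R u w"
| pres_append: "pres_eq R u u' \<Longrightarrow> pres_eq R v v' \<Longrightarrow> pres_eq R (u @ v) (u' @ v')"
| pres_cancel: "pres_eq R [(g, e), (g, \<not> e)] []"
| pres_rel: "(u, v) \<in> R \<Longrightarrow> pres_eq R u v"

definition pres_class :: "('g gword \<times> 'g gword) set \<Rightarrow> 'g gword \<Rightarrow> 'g gword set" where
  "pres_class R u = {v. pres_eq R u v}"

definition presented_group :: "('g gword \<times> 'g gword) set \<Rightarrow> 'g gword set monoid" where
  "presented_group R =
     \<lparr>carrier = range (pres_class R),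
      monoid.mult = (\<lambda>A B. {w. \<exists>u\<in>A. \<exists>v\<in>B. pres_eq R (u @ v) w}),
      one = pres_class R []\<rparr>"

lemma pres_class_eq_iff: "pres_class R u = pres_class R v \<longleftrightarrow> pres_eq R u v"
  unfolding pres_class_def
  by (auto intro: pres_refl pres_sym pres_trans)

lemma presented_group_mult:
  "pres_class R u \<otimes>\<^bsub>presented_group R\<^esub> pres_class R v = pres_class R (u @ v)"
  unfolding presented_group_def pres_class_def
  by (auto intro: pres_refl pres_trans pres_append)

lemma pres_gword_inv: "pres_eq R (gword_inv w @ w) []"
proof (induction w)
  case Nil
  show ?case by (simp add: gword_inv_def pres_refl)
next
  case (Cons x w)
  obtain g e where x: "x = (g, e)" by (cases x)
  have "pres_eq R [(g, \<not> e), (g, e)] []"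
    using pres_cancel[of R g "\<not> e"] by simp
  then have "pres_eq R ([(g, \<not> e), (g, e)] @ w) ([] @ w)"
    by (rule pres_append) (rule pres_refl)
  then have "pres_eq R (gword_inv w @ ([(g, \<not> e), (g, e)] @ w)) (gword_inv w @ ([] @ w))"
    by (rule pres_append[OF pres_refl])
  then have "pres_eq R (gword_inv (x # w) @ (x # w)) (gword_inv w @ w)"
    by (simp add: gword_inv_def x)
  then show ?case using Cons.IH by (rule pres_trans)
qed

lemma group_presented_group: "group (presented_group R)"
proof (rule groupI)
  fix x assume "x \<in> carrier (presented_group R)"
  then obtain u where x: "x = pres_class R u" by (auto simp: presented_group_def)
  have "pres_class R (gword_inv u) \<otimes>\<^bsub>presented_group R\<^esub> x = \<one>\<^bsub>presented_group R\<^esub>"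
    unfolding x presented_group_mult
    by (simp add: presented_group_def pres_class_eq_iff pres_gword_inv)
  then show "\<exists>y\<in>carrier (presented_group R). y \<otimes>\<^bsub>presented_group R\<^esub> x = \<one>\<^bsub>presented_group R\<^esub>"
    by (auto simp: presented_group_def)
next
  fix x assume "x \<in> carrier (presented_group R)"
  then obtain u where x: "x = pres_class R u" by (auto simp: presented_group_def)
  have "\<one>\<^bsub>presented_group R\<^esub> = pres_class R []" by (simp add: presented_group_def)
  then show "\<one>\<^bsub>presented_group R\<^esub> \<otimes>\<^bsub>presented_group R\<^esub> x = x"
    using presented_group_mult[of R "[]" u] by (simp add: x)
next
  fix x y assume "x \<in> carrier (presented_group R)" "y \<in> carrier (presented_group R)"
  then obtain u v where "x = pres_class R u" "y = pres_class R v"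
    by (auto simp: presented_group_def)
  then have "x \<otimes>\<^bsub>presented_group R\<^esub> y = pres_class R (u @ v)"
    by (simp add: presented_group_mult)
  then show "x \<otimes>\<^bsub>presented_group R\<^esub> y \<in> carrier (presented_group R)"
    by (simp add: presented_group_def)
next
  fix x y z
  assume "x \<in> carrier (presented_group R)" "y \<in> carrier (presented_group R)"
    "z \<in> carrier (presented_group R)"
  then obtain u v w where "x = pres_class R u" "y = pres_class R v" "z = pres_class R w"
    by (auto simp: presented_group_def)
  then show "x \<otimes>\<^bsub>presented_group R\<^esub> y \<otimes>\<^bsub>presented_group R\<^esub> z =
      x \<otimes>\<^bsub>presented_group R\<^esub> (y \<otimes>\<^bsub>presented_group R\<^esub> z)"
    by (simp add: presented_group_mult)
qed (simp add: presented_group_def)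

record 'a ranked_poset = "'a partial_object" +
  order_rel :: "'a rel"
  rank_of :: "'a \<Rightarrow> nat"

definition incident :: "('a, 'b) ranked_poset_scheme \<Rightarrow> 'a \<Rightarrow> 'a \<Rightarrow> bool" where
  "incident P x y \<longleftrightarrow> x \<in> carrier P \<and> y \<in> carrier P \<and> x \<noteq> y \<and>
     ((x, y) \<in> order_rel P \<or> (y, x) \<in> order_rel P)"

definition elems_of_rank :: "('a, 'b) ranked_poset_scheme \<Rightarrow> nat \<Rightarrow> 'a set" where
  "elems_of_rank P i = {x \<in> carrier P. rank_of P x = i}"

text \<open>Connectedness of the subgraph of the incidence graph induced on \<open>S\<close>; the empty graph does
  not count as connected.\<close>

definition incidence_connected :: "('a, 'b) ranked_poset_scheme \<Rightarrow> 'a set \<Rightarrow> bool" where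
  "incidence_connected P S \<longleftrightarrow> S \<noteq> {} \<and>
     (\<forall>x\<in>S. \<forall>y\<in>S. (x, y) \<in> {(a, b). a \<in> S \<and> b \<in> S \<and> incident P a b}\<^sup>*)"

definition polyhedron :: "('a, 'b) ranked_poset_scheme \<Rightarrow> bool" where
  "polyhedron P \<longleftrightarrow>
     partial_order_on (carrier P) (order_rel P) \<and>
     (\<forall>x\<in>carrier P. rank_of P x \<in> {0, 1, 2}) \<and>
     (\<forall>x y. (x, y) \<in> order_rel P \<and> x \<noteq> y \<longrightarrow> rank_of P x < rank_of P y) \<and>
     (\<forall>e\<in>elems_of_rank P 1.
        card {v \<in> elems_of_rank P 0. incident P v e} = 2 \<and>
        card {f \<in> elems_of_rank P 2. incident P f e} = 2) \<and>
     (\<forall>v\<in>elems_of_rank P 0. \<forall>f\<in>elems_of_rank P 2. incident P v f \<longrightarrow>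
        card {e \<in> elems_of_rank P 1. incident P e v \<and> incident P e f} = 2) \<and>
     incidence_connected P (carrier P) \<and>
     (\<forall>x\<in>elems_of_rank P 0 \<union> elems_of_rank P 2. incidence_connected P {y. incident P x y})"

type_synonym 'a flag = "'a \<times> 'a \<times> 'a"

definition flags :: "('a, 'b) ranked_poset_scheme \<Rightarrow> 'a flag set" where
  "flags P = {(v, e, f). v \<in> elems_of_rank P 0 \<and> e \<in> elems_of_rank P 1 \<and> f \<in> elems_of_rank P 2 \<and>
     incident P v e \<and> incident P e f \<and> incident P v f}"

fun flag_elem :: "'a flag \<Rightarrow> nat \<Rightarrow> 'a" where
  "flag_elem (v, e, f) i = (if i = 0 then v else if i = 1 then e else f)"

definition flag_adj :: "('a, 'b) ranked_poset_scheme \<Rightarrow> nat \<Rightarrow> 'a flag \<Rightarrow> 'a flag" where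
  "flag_adj P i \<Phi> =
     (THE \<Psi>. \<Psi> \<in> flags P \<and> (\<forall>j\<in>{0, 1, 2}. flag_elem \<Psi> j \<noteq> flag_elem \<Phi> j \<longleftrightarrow> j = i))"

fun map_flag :: "('a \<Rightarrow> 'b) \<Rightarrow> 'a flag \<Rightarrow> 'b flag" where
  "map_flag h (v, e, f) = (h v, h e, h f)"

text \<open>Automorphisms act on the right, as is usual for polytopes: the product of \<open>g\<close> and \<open>h\<close> is
  \<open>g\<close> followed by \<open>h\<close>.\<close>

definition poset_aut_group :: "('a, 'b) ranked_poset_scheme \<Rightarrow> ('a \<Rightarrow> 'a) monoid" where
  "poset_aut_group P =
     \<lparr>carrier = {h \<in> Bij (carrier P). \<forall>x\<in>carrier P. \<forall>y\<in>carrier P.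
                   (h x, h y) \<in> order_rel P \<longleftrightarrow> (x, y) \<in> order_rel P},
      monoid.mult = (\<lambda>g h. compose (carrier P) h g),
      one = (\<lambda>x\<in>carrier P. x)\<rparr>"

definition aut_transitive_on :: "('a, 'b) ranked_poset_scheme \<Rightarrow> 'a flag set \<Rightarrow> bool" where
  "aut_transitive_on P C \<longleftrightarrow>
     (\<forall>\<Phi>\<in>C. \<forall>\<Psi>\<in>C. \<exists>h\<in>carrier (poset_aut_group P). map_flag h \<Phi> = \<Psi>)"

definition chiral :: "('a, 'b) ranked_poset_scheme \<Rightarrow> bool" where
  "chiral P \<longleftrightarrow> polyhedron P \<and>
     (\<exists>C D. flags P = C \<union> D \<and> C \<inter> D = {} \<and>
        (\<forall>\<Phi>\<in>flags P. \<forall>i\<in>{0, 1, 2}. flag_adj P i \<Phi> \<in> C \<longleftrightarrow> \<Phi> \<in> D) \<and>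
        aut_transitive_on P C \<and> aut_transitive_on P D) \<and>
     \<not> aut_transitive_on P (flags P)"

definition has_type :: "('a, 'b) ranked_poset_scheme \<Rightarrow> nat \<Rightarrow> nat \<Rightarrow> bool" where
  "has_type P p q \<longleftrightarrow>
     (\<forall>f\<in>elems_of_rank P 2. card {e \<in> elems_of_rank P 1. incident P e f} = p) \<and>
     (\<forall>v\<in>elems_of_rank P 0. card {e \<in> elems_of_rank P 1. incident P e v} = q)"

definition tight_of_type :: "('a, 'b) ranked_poset_scheme \<Rightarrow> nat \<Rightarrow> nat \<Rightarrow> bool" where
  "tight_of_type P p q \<longleftrightarrow> has_type P p q \<and> card (flags P) = 2 * p * q"

definition is_aut_group_with_gens ::
    "('g, 'c) monoid_scheme \<Rightarrow> 'g \<Rightarrow> 'g \<Rightarrow> ('a, 'b) ranked_poset_scheme \<Rightarrow> bool" where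
  "is_aut_group_with_gens G s1 s2 P \<longleftrightarrow>
     (\<exists>\<Phi>\<in>flags P. \<exists>h\<in>iso G (poset_aut_group P).
        map_flag (h s1) \<Phi> = flag_adj P 0 (flag_adj P 1 \<Phi>) \<and>
        map_flag (h s2) \<Phi> = flag_adj P 1 (flag_adj P 2 \<Phi>))"

text \<open>A polyhedron with finitely many flags is finite, so it is no restriction to take its elements
  in \<^typ>\<open>nat\<close>; here \<open>p\<close> and \<open>q\<close> are positive.\<close>

definition is_aut_group_of_tight_chiral_polyhedron ::
    "('g, 'c) monoid_scheme \<Rightarrow> 'g \<Rightarrow> 'g \<Rightarrow> nat \<Rightarrow> nat \<Rightarrow> bool" where
  "is_aut_group_of_tight_chiral_polyhedron G s1 s2 p q \<longleftrightarrow>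
     (\<exists>P :: nat ranked_poset. chiral P \<and> tight_of_type P p q \<and> is_aut_group_with_gens G s1 s2 P)"

datatype gen = Sigma1 | Sigma2

abbreviation \<sigma>1 :: "gen gword" where "\<sigma>1 \<equiv> [(Sigma1, True)]"
abbreviation \<sigma>2 :: "gen gword" where "\<sigma>2 \<equiv> [(Sigma2, True)]"

definition rels_first :: "nat \<Rightarrow> nat \<Rightarrow> int \<Rightarrow> (gen gword \<times> gen gword) set" where
  "rels_first m \<beta> k =
     {(gword_pow \<sigma>1 (2 * int m ^ \<beta>), []),
      (gword_pow \<sigma>2 (int m ^ \<beta>), []),
      (gword_pow (\<sigma>1 @ \<sigma>2) 2, []),
      (gword_pow \<sigma>2 (-1) @ \<sigma>1,
       gword_pow \<sigma>1 (3 + k * (int m + 1) * int m ^ (\<beta> - 1)) @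
       gword_pow \<sigma>2 (1 + k * int m ^ (\<beta> - 1))),
      (\<sigma>2 @ gword_pow \<sigma>1 (-1),
       gword_pow \<sigma>1 (-3 + k * (int m + 1) * int m ^ (\<beta> - 1)) @
       gword_pow \<sigma>2 (-1 + k * int m ^ (\<beta> - 1))),
      (gword_pow \<sigma>1 (2 * int m) @ \<sigma>2, \<sigma>2 @ gword_pow \<sigma>1 (2 * int m))}"

definition rels_second :: "nat \<Rightarrow> nat \<Rightarrow> nat \<Rightarrow> int \<Rightarrow> (gen gword \<times> gen gword) set" where
  "rels_second m \<alpha> \<beta> k =
     {(gword_pow \<sigma>1 (2 * int m ^ \<alpha>), []),
      (gword_pow \<sigma>2 (int m ^ \<beta>), []),
      (gword_pow (\<sigma>1 @ \<sigma>2) 2, []),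
      (gword_pow \<sigma>2 (-1) @ \<sigma>1,
       gword_pow \<sigma>1 3 @ gword_pow \<sigma>2 (1 + k * int m ^ (\<beta> - 1))),
      (\<sigma>2 @ gword_pow \<sigma>1 (-1),
       gword_pow \<sigma>1 (-3) @ gword_pow \<sigma>2 (-1 + k * int m ^ (\<beta> - 1))),
      (gword_pow \<sigma>1 (2 * int m) @ \<sigma>2, \<sigma>2 @ gword_pow \<sigma>1 (2 * int m))}"

end

theory Submission
  imports Defs "HOL-Library.Countable_Set" "HOL-Number_Theory.Cong"
begin

text \<open>
  Both presentations are instances of one family, with \<open>\<sigma>1\<close> of order \<open>2 m^\<alpha>\<close> where \<open>\<alpha> \<le> \<beta>\<close>.

  If a group is generated by \<open>\<sigma>1\<close> and \<open>\<sigma>2\<close> of orders \<open>p\<close> and \<open>q\<close>, \<open>\<sigma>1 \<sigma>2\<close> is an involution and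
  every element is uniquely \<open>\<sigma>1^a \<sigma>2^b\<close>, then the right cosets of \<open>\<langle>\<sigma>2\<rangle>\<close>, \<open>\<langle>\<sigma>1 \<sigma>2\<rangle>\<close>, \<open>\<langle>\<sigma>1\<rangle>\<close> are the vertices,
  edges and faces of a tight polyhedron, two flags for each group element. An automorphism that
  exchanges the two classes of flags would make \<open>\<sigma>1 \<mapsto> \<sigma>1^-1, \<sigma>2 \<mapsto> \<sigma>2^-1\<close> respect every relation.
  Applied to the fourth relation and compared with the fifth this gives \<open>\<sigma>1^(2A) \<sigma>2^(2B) = 1\<close>,
  where \<open>B = k m^(\<beta>-1)\<close> and \<open>A\<close> is the correction to the exponents \<open>3\<close> and \<open>-3\<close>; so \<open>m^\<beta>\<close> divides \<open>2B\<close>,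
  which is false.

  That every element has the form \<open>\<sigma>1^a \<sigma>2^b\<close> follows because \<open>\<langle>\<sigma>1^2, \<sigma>2\<rangle>\<close> has class at most two, with
  commutator \<open>[\<sigma>1^2, \<sigma>2]\<close> of order dividing \<open>m\<close>. Uniqueness is read off a metacyclic quotient
  \<open>Z/m^\<beta> : Z/2m^\<alpha>\<close>: words act on \<open>Z/m^\<beta>\<close> by the affine maps \<open>\<sigma>1: x \<mapsto> (t-1) x\<close> and
  \<open>\<sigma>2: x \<mapsto> 1 + (1+t) x\<close> with \<open>2t = B\<close>, \<open>t^2 = 0\<close>, and have weights in \<open>Z/2m^\<alpha>\<close> given by
  \<open>\<sigma>1 \<mapsto> 1\<close>, \<open>\<sigma>2 \<mapsto> m^\<alpha> - 1\<close>.
\<close>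

section \<open>The coset geometry of a tight rotation group\<close>

lemma (in group) inv_mult_cancel [simp]:
  "x \<in> carrier G \<Longrightarrow> y \<in> carrier G \<Longrightarrow> inv x \<otimes> (x \<otimes> y) = y"
  "x \<in> carrier G \<Longrightarrow> y \<in> carrier G \<Longrightarrow> x \<otimes> (inv x \<otimes> y) = y"
  by (simp_all flip: m_assoc)

lemma incident_sym: "incident P x y \<longleftrightarrow> incident P y x"
  by (auto simp: incident_def)

text \<open>Incidence is symmetric, so it is enough to reach every element from one base
  point.\<close>

lemma incidence_connectedI:
  assumes "b \<in> S"
    and "\<And>x. x \<in> S \<Longrightarrow> (b, x) \<in> {(a, b). a \<in> S \<and> b \<in> S \<and> incident P a b}\<^sup>*"
  shows "incidence_connected P S"
proof -
  have "sym {(a, b). a \<in> S \<and> b \<in> S \<and> incident P a b}"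
    by (auto simp: sym_def incident_sym)
  then have "sym ({(a, b). a \<in> S \<and> b \<in> S \<and> incident P a b}\<^sup>*)" by (rule sym_rtrancl)
  then show ?thesis unfolding incidence_connected_def using assms
    by (meson empty_iff rtrancl_trans symD)
qed

text \<open>Automorphisms are only assumed to preserve the order. They also preserve the ranks in a
  flag, because the image is again a strict chain of three elements and its ranks must increase
  inside {0, 1, 2}.\<close>

lemma map_flag_aut:
  assumes P: "polyhedron P" and h: "h \<in> carrier (poset_aut_group P)" and F: "F \<in> flags P"
  shows "map_flag h F \<in> flags P"
proof -
  have rank_less: "rank_of P x < rank_of P y" if "(x, y) \<in> order_rel P" "x \<noteq> y" for x y
    using P that by (auto simp: polyhedron_def)
  obtain v e f where F': "F = (v, e, f)" "v \<in> carrier P" "e \<in> carrier P" "f \<in> carrier P"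
    "rank_of P v = 0" "rank_of P e = 1" "rank_of P f = 2"
    "incident P v e" "incident P e f" "incident P v f"
    using F by (auto simp: flags_def elems_of_rank_def)
  have bij: "bij_betw h (carrier P) (carrier P)" and
    ord: "\<And>x y. x \<in> carrier P \<Longrightarrow> y \<in> carrier P \<Longrightarrow> (h x, h y) \<in> order_rel P \<longleftrightarrow> (x, y) \<in> order_rel P"
    using h by (auto simp: poset_aut_group_def Bij_def)
  have closed: "h x \<in> carrier P" if "x \<in> carrier P" for x using bij that by (auto simp: bij_betw_def)
  have inj: "h x = h y \<longleftrightarrow> x = y" if "x \<in> carrier P" "y \<in> carrier P" for x y
    using bij that by (auto simp: bij_betw_def inj_on_def)
  have inc: "incident P (h x) (h y) \<longleftrightarrow> incident P x y" if "x \<in> carrier P" "y \<in> carrier P" for x y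
    using that closed inj ord by (auto simp: incident_def)
  have "(v, e) \<in> order_rel P" "(e, f) \<in> order_rel P" "v \<noteq> e" "e \<noteq> f"
    using F' rank_less[of e v] rank_less[of f e] by (auto simp: incident_def)
  then have "rank_of P (h v) < rank_of P (h e)" "rank_of P (h e) < rank_of P (h f)"
    using F' ord inj by (auto intro!: rank_less)
  moreover have "rank_of P (h f) \<in> {0, 1, 2}" using P closed F' by (simp add: polyhedron_def)
  ultimately have "rank_of P (h v) = 0" "rank_of P (h e) = 1" "rank_of P (h f) = 2" by auto
  then show ?thesis using F' closed inc by (simp add: flags_def elems_of_rank_def)
qed

text \<open>The condition inside the definite description of \<open>flag_adj\<close>, as a relation
  that can be used before existence and uniqueness are known.\<close>

definition adjacent_flags :: "nat \<Rightarrow> 'a flag \<Rightarrow> 'a flag \<Rightarrow> bool" where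
  "adjacent_flags i F F' \<longleftrightarrow> (\<forall>j\<in>{0, 1, 2}. flag_elem F' j \<noteq> flag_elem F j \<longleftrightarrow> j = i)"

text \<open>Together \<open>generated\<close> and \<open>independent\<close> say that
  \<open>G\<close> is the product of cyclic subgroups of orders \<open>p\<close> and
  \<open>q\<close> that meet trivially. Its order is therefore \<open>p * q\<close>, half the number
  of flags of a tight polyhedron.\<close>

locale tight_rotation_group = group G for G (structure) +
  fixes s1 s2 :: 'a and p q :: nat
  assumes s1 [simp]: "s1 \<in> carrier G" and s2 [simp]: "s2 \<in> carrier G"
    and p3: "3 \<le> p" and q3: "3 \<le> q"
    and s1_pow: "s1 [^] p = \<one>" and s2_pow: "s2 [^] q = \<one>"
    and s12: "s1 \<otimes> s2 \<otimes> (s1 \<otimes> s2) = \<one>"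
    and generated: "g \<in> carrier G \<Longrightarrow> \<exists>(a::nat) (b::nat). g = s1 [^] a \<otimes> s2 [^] b"
    and independent: "s1 [^] (a::nat) \<otimes> s2 [^] (b::nat) = \<one> \<Longrightarrow> p dvd a \<and> q dvd b"
begin

declare One_nat_def [simp del]

lemma pow_1 [simp]: "x \<in> carrier G \<Longrightarrow> x [^] (1::nat) = x"
  by (simp add: One_nat_def)

text \<open>Right cosets, so that right multiplication acts on them. Natural exponents suffice
  because the generators have finite order.\<close>

definition coset :: "nat \<Rightarrow> 'a \<Rightarrow> 'a set" where
  "coset i g = (if i = 0 then {s2 [^] b \<otimes> g | b :: nat. True}
     else if i = 1 then {g, s1 \<otimes> s2 \<otimes> g} else {s1 [^] a \<otimes> g | a :: nat. True})"

text \<open>A natural number that codes a coset together with its rank. The residue modulo 3 is the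
  rank, so elements of different ranks never coincide, even if their cosets are equal as
  sets.\<close>

definition el :: "nat \<Rightarrow> 'a \<Rightarrow> nat" where
  "el i g = 3 * to_nat_on (Pow (carrier G)) (coset i g) + i"

text \<open>The coset geometry: two elements are comparable when their cosets have a common group
  element \<open>g\<close>.\<close>

definition geom :: "nat ranked_poset" where
  "geom = \<lparr>carrier = {el i g | i g. i < 3 \<and> g \<in> carrier G},
     order_rel = {(el i g, el j g) | i j g. i \<le> j \<and> j < 3 \<and> g \<in> carrier G},
     rank_of = (\<lambda>x. x mod 3)\<rparr>"

section \<open>Exponent arithmetic and the cyclic subgroups of \<open>s1\<close>, \<open>s2\<close>
  and \<open>s1 \<otimes> s2\<close>\<close>

lemma s1_pow_mod: "s1 [^] (a mod p) = s1 [^] a"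
proof -
  have "s1 [^] a = s1 [^] (p * (a div p) + a mod p)" by simp
  also have "\<dots> = s1 [^] (a mod p)"
    by (simp only: nat_pow_mult[symmetric] nat_pow_pow[symmetric] s1 s1_pow nat_pow_one) simp
  finally show ?thesis by simp
qed

lemma s2_pow_mod: "s2 [^] (a mod q) = s2 [^] a"
proof -
  have "s2 [^] a = s2 [^] (q * (a div q) + a mod q)" by simp
  also have "\<dots> = s2 [^] (a mod q)"
    by (simp only: nat_pow_mult[symmetric] nat_pow_pow[symmetric] s2 s2_pow nat_pow_one) simp
  finally show ?thesis by simp
qed

lemma carrier_eq: "carrier G = (\<lambda>(a, b). s1 [^] a \<otimes> s2 [^] b) ` ({..<p} \<times> {..<q})"
proof
  show "carrier G \<subseteq> (\<lambda>(a, b). s1 [^] a \<otimes> s2 [^] b) ` ({..<p} \<times> {..<q})"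
  proof
    fix g assume g: "g \<in> carrier G"
    obtain a b :: nat where "g = s1 [^] a \<otimes> s2 [^] b" using generated[OF g] by blast
    then have "g = s1 [^] (a mod p) \<otimes> s2 [^] (b mod q)" by (simp only: s1_pow_mod s2_pow_mod)
    moreover have "a mod p < p" "b mod q < q" using p3 q3 by simp_all
    ultimately show "g \<in> (\<lambda>(a, b). s1 [^] a \<otimes> s2 [^] b) ` ({..<p} \<times> {..<q})"
      by (intro image_eqI[of _ _ "(a mod p, b mod q)"]) simp_all
  qed
qed auto

lemma finite_carrier: "finite (carrier G)"
  by (simp add: carrier_eq)

lemma s1_pow_inv: "inv (s1 [^] (a::nat)) = s1 [^] ((p - 1) * a)"
proof -
  have "s1 [^] ((p - 1) * a) \<otimes> s1 [^] a = s1 [^] (p * a)"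
    using p3 by (cases p) (simp_all add: nat_pow_mult add.commute)
  also have "\<dots> = \<one>" by (simp only: nat_pow_pow[symmetric] s1 s1_pow nat_pow_one)
  finally show ?thesis by (simp add: inv_equality)
qed

lemma s2_pow_inv: "inv (s2 [^] (a::nat)) = s2 [^] ((q - 1) * a)"
proof -
  have "s2 [^] ((q - 1) * a) \<otimes> s2 [^] a = s2 [^] (q * a)"
    using q3 by (cases q) (simp_all add: nat_pow_mult add.commute)
  also have "\<dots> = \<one>" by (simp only: nat_pow_pow[symmetric] s2 s2_pow nat_pow_one)
  finally show ?thesis by (simp add: inv_equality)
qed

text \<open>Moving \<open>s2 [^] b\<close> to the left turns the equation into a normal form of the
  identity. This is why a vertex and a face share at most one group element.\<close>

lemma powers_meet: "s1 [^] (a::nat) = s2 [^] (b::nat) \<Longrightarrow> p dvd a \<and> q dvd b"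
proof -
  assume eq: "s1 [^] a = s2 [^] b"
  have "s1 [^] a \<otimes> s2 [^] ((q - 1) * b) = \<one>"
    unfolding eq s2_pow_inv[symmetric] by simp
  then have "p dvd a" using independent by blast
  then have "s1 [^] (0::nat) \<otimes> s2 [^] b = \<one>"
    using eq s1_pow_mod[of a] by simp
  then show ?thesis using \<open>p dvd a\<close> independent by blast
qed

lemma powers_meet_one: "s1 [^] (a::nat) = s2 [^] (b::nat) \<Longrightarrow> s1 [^] a = \<one>"
  using powers_meet[of a b] s1_pow_mod[of a] by simp

lemma tau_eq: "s1 \<otimes> s2 = inv s2 \<otimes> inv s1"
  using inv_equality[OF s12] by (simp add: inv_mult_group)

lemma tau_tau [simp]: "g \<in> carrier G \<Longrightarrow> s1 \<otimes> (s2 \<otimes> (s1 \<otimes> (s2 \<otimes> g))) = g"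
  using arg_cong[OF s12, of "\<lambda>h. h \<otimes> g"] by (simp add: m_assoc)

lemma s1_not_one: "s1 \<noteq> \<one>"
  using powers_meet[of 1 0] p3 by auto
lemma s2_not_one: "s2 \<noteq> \<one>"
  using powers_meet[of 0 1] q3 by auto
text \<open>Otherwise \<open>s1\<close> would be a power of \<open>s2\<close>. With the analogous
  fact for \<open>s1\<close> below, this gives every edge two different vertices and two different
  faces.\<close>

lemma tau_not_s2_power: "s1 \<otimes> s2 \<noteq> s2 [^] (b::nat)"
proof
  assume "s1 \<otimes> s2 = s2 [^] b"
  then have "s1 = s2 [^] b \<otimes> inv s2" by (metis inv_solve_right nat_pow_closed s1 s2)
  also have "\<dots> = s2 [^] (b + (q - 1))" using s2_pow_inv[of 1] by (simp add: nat_pow_mult)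
  finally show False using powers_meet[of 1 "b + (q - 1)"] p3 by auto
qed
lemma tau_not_s1_power: "s1 \<otimes> s2 \<noteq> s1 [^] (a::nat)"
proof
  assume "s1 \<otimes> s2 = s1 [^] a"
  then have "s2 = inv s1 \<otimes> s1 [^] a" by (metis inv_solve_left nat_pow_closed s1 s2)
  also have "\<dots> = s1 [^] ((p - 1) + a)" using s1_pow_inv[of 1] by (simp add: nat_pow_mult)
  finally show False using powers_meet[of "(p - 1) + a" 1] q3 by auto
qed

section \<open>Equality of cosets\<close>

lemma coset_subset: "g \<in> carrier G \<Longrightarrow> coset i g \<subseteq> carrier G"
  by (auto simp: coset_def)

lemma self_in_coset: "g \<in> carrier G \<Longrightarrow> g \<in> coset i g"
  unfolding coset_def by (auto intro: exI[of _ "0::nat"])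

lemma el_mod [simp]: "i < 3 \<Longrightarrow> el i g mod 3 = i"
  by (simp add: el_def)

lemma el_eq_iff:
  assumes "i < 3" "j < 3" "g \<in> carrier G" "h \<in> carrier G"
  shows "el i g = el j h \<longleftrightarrow> i = j \<and> coset i g = coset i h"
proof
  assume eq: "el i g = el j h"
  then have "i = j" using el_mod assms by metis
  moreover have "inj_on (to_nat_on (Pow (carrier G))) (Pow (carrier G))"
    by (intro inj_on_to_nat_on countable_finite) (simp add: finite_carrier)
  ultimately show "i = j \<and> coset i g = coset i h"
    using eq coset_subset assms by (auto simp: el_def inj_on_def)
qed (auto simp: el_def)

lemma el0_eq_iff:
  assumes [simp]: "g \<in> carrier G" "h \<in> carrier G"
  shows "el 0 g = el 0 h \<longleftrightarrow> (\<exists>b::nat. g = s2 [^] b \<otimes> h)"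
proof
  assume "el 0 g = el 0 h"
  then have "g \<in> coset 0 h" using self_in_coset[of g 0] by (simp add: el_eq_iff)
  then show "\<exists>b::nat. g = s2 [^] b \<otimes> h" by (auto simp: coset_def)
next
  assume "\<exists>b::nat. g = s2 [^] b \<otimes> h"
  then obtain b :: nat where g: "g = s2 [^] b \<otimes> h" by blast
  have h: "h = s2 [^] ((q - 1) * b) \<otimes> g"
    unfolding g by (simp add: s2_pow_inv[symmetric])
  have "coset 0 g = coset 0 h"
  proof
    show "coset 0 g \<subseteq> coset 0 h"
      by (auto simp: coset_def g m_assoc[symmetric] nat_pow_mult)
    have "s2 [^] c \<otimes> h = s2 [^] (c + (q - 1) * b) \<otimes> g" for c :: nat
      by (subst h) (simp add: m_assoc[symmetric] nat_pow_mult)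
    then show "coset 0 h \<subseteq> coset 0 g" by (auto simp: coset_def)
  qed
  then show "el 0 g = el 0 h" by (simp add: el_eq_iff)
qed

lemma el2_eq_iff:
  assumes [simp]: "g \<in> carrier G" "h \<in> carrier G"
  shows "el 2 g = el 2 h \<longleftrightarrow> (\<exists>b::nat. g = s1 [^] b \<otimes> h)"
proof
  assume "el 2 g = el 2 h"
  then have "g \<in> coset 2 h" using self_in_coset[of g 2] by (simp add: el_eq_iff)
  then show "\<exists>b::nat. g = s1 [^] b \<otimes> h" by (auto simp: coset_def)
next
  assume "\<exists>b::nat. g = s1 [^] b \<otimes> h"
  then obtain b :: nat where g: "g = s1 [^] b \<otimes> h" by blast
  have h: "h = s1 [^] ((p - 1) * b) \<otimes> g"
    unfolding g by (simp add: s1_pow_inv[symmetric])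
  have "coset 2 g = coset 2 h"
  proof
    show "coset 2 g \<subseteq> coset 2 h"
      by (auto simp: coset_def g m_assoc[symmetric] nat_pow_mult)
    have "s1 [^] c \<otimes> h = s1 [^] (c + (p - 1) * b) \<otimes> g" for c :: nat
      by (subst h) (simp add: m_assoc[symmetric] nat_pow_mult)
    then show "coset 2 h \<subseteq> coset 2 g" by (auto simp: coset_def)
  qed
  then show "el 2 g = el 2 h" by (simp add: el_eq_iff)
qed

lemma el1_eq_iff:
  assumes [simp]: "g \<in> carrier G" "h \<in> carrier G"
  shows "el 1 g = el 1 h \<longleftrightarrow> g = h \<or> g = s1 \<otimes> (s2 \<otimes> h)"
proof
  assume "el 1 g = el 1 h"
  then have "g \<in> coset 1 h" using self_in_coset[of g 1] by (simp add: el_eq_iff)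
  then show "g = h \<or> g = s1 \<otimes> (s2 \<otimes> h)" by (auto simp: coset_def m_assoc)
next
  assume "g = h \<or> g = s1 \<otimes> (s2 \<otimes> h)"
  then have "coset 1 g = coset 1 h" by (auto simp: coset_def m_assoc)
  then show "el 1 g = el 1 h" by (simp add: el_eq_iff)
qed

lemma el02_inj:
  assumes "g \<in> carrier G" "h \<in> carrier G" "el 0 g = el 0 h" "el 2 g = el 2 h"
  shows "g = h"
proof -
  obtain b :: nat where b: "g = s2 [^] b \<otimes> h" using assms el0_eq_iff by blast
  obtain a :: nat where a: "g = s1 [^] a \<otimes> h" using assms el2_eq_iff by blast
  have "s1 [^] a = s2 [^] b" using assms a b
    by (metis nat_pow_closed right_cancel s1 s2)
  with a b show ?thesis using powers_meet_one[of a b] assms by simp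
qed

lemma el0_s2 [simp]: "g \<in> carrier G \<Longrightarrow> el 0 (s2 \<otimes> g) = el 0 g"
  by (subst el0_eq_iff) (auto intro!: exI[of _ "1::nat"])
lemma el0_inv_s2 [simp]: "g \<in> carrier G \<Longrightarrow> el 0 (inv s2 \<otimes> g) = el 0 g"
  using el0_s2[of "inv s2 \<otimes> g"] by simp
lemma el2_s1 [simp]: "g \<in> carrier G \<Longrightarrow> el 2 (s1 \<otimes> g) = el 2 g"
  by (subst el2_eq_iff) (auto intro!: exI[of _ "1::nat"])
lemma el2_inv_s1 [simp]: "g \<in> carrier G \<Longrightarrow> el 2 (inv s1 \<otimes> g) = el 2 g"
  using el2_s1[of "inv s1 \<otimes> g"] by simp
lemma el1_tau [simp]: "g \<in> carrier G \<Longrightarrow> el 1 (s1 \<otimes> (s2 \<otimes> g)) = el 1 g"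
  by (subst el1_eq_iff) auto
lemma tau_eq_left: "g \<in> carrier G \<Longrightarrow> s1 \<otimes> (s2 \<otimes> g) = inv s2 \<otimes> (inv s1 \<otimes> g)"
  using arg_cong[OF tau_eq, of "\<lambda>h. h \<otimes> g"] by (simp add: m_assoc)
lemma el0_tau: "g \<in> carrier G \<Longrightarrow> el 0 (s1 \<otimes> (s2 \<otimes> g)) = el 0 (inv s1 \<otimes> g)"
  by (simp add: tau_eq_left)
text \<open>The involution \<open>s1 \<otimes> s2\<close> sends \<open>inv s2 \<otimes> g\<close> to
  \<open>s1 \<otimes> g\<close>. As these two elements lie in the vertex and in the face of
  \<open>g\<close> respectively, their common edge is the second edge between that vertex and that
  face.\<close>

lemma el1_inv_s2: "g \<in> carrier G \<Longrightarrow> el 1 (inv s2 \<otimes> g) = el 1 (s1 \<otimes> g)"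
  using el1_tau[of "inv s2 \<otimes> g"] by simp
lemma el0_tau_neq:
  assumes [simp]: "g \<in> carrier G"
  shows "el 0 (s1 \<otimes> (s2 \<otimes> g)) \<noteq> el 0 g"
proof
  assume "el 0 (s1 \<otimes> (s2 \<otimes> g)) = el 0 g"
  then obtain b :: nat where "s1 \<otimes> s2 \<otimes> g = s2 [^] b \<otimes> g"
    by (auto simp: el0_eq_iff m_assoc)
  then show False using tau_not_s2_power[of b] by simp
qed
lemma el2_tau_neq:
  assumes [simp]: "g \<in> carrier G"
  shows "el 2 (s1 \<otimes> (s2 \<otimes> g)) \<noteq> el 2 g"
proof
  assume "el 2 (s1 \<otimes> (s2 \<otimes> g)) = el 2 g"
  then obtain b :: nat where "s1 \<otimes> s2 \<otimes> g = s1 [^] b \<otimes> g"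
    using el2_eq_iff[of "s1 \<otimes> (s2 \<otimes> g)" g] by (metis assms m_assoc m_closed s1 s2)
  then show False using tau_not_s1_power[of b] by simp
qed
lemma el1_s1_neq: "g \<in> carrier G \<Longrightarrow> el 1 (s1 \<otimes> g) \<noteq> el 1 g"
  using s1_not_one s2_not_one by (auto simp: el1_eq_iff)

section \<open>The order and the incidence relation of the coset geometry\<close>

lemma carrier_geom: "x \<in> carrier geom \<longleftrightarrow> (\<exists>i g. i < 3 \<and> g \<in> carrier G \<and> x = el i g)"
  by (auto simp: geom_def)

lemma el_carrier [simp]: "i < 3 \<Longrightarrow> g \<in> carrier G \<Longrightarrow> el i g \<in> carrier geom"
  by (auto simp: carrier_geom)

lemma elems_of_rank_geom: "i < 3 \<Longrightarrow> elems_of_rank geom i = el i ` carrier G"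
  by (auto simp: elems_of_rank_def carrier_geom geom_def)

lemma order_rel_geom:
  "(x, y) \<in> order_rel geom \<longleftrightarrow>
     (\<exists>i j g. i \<le> j \<and> j < 3 \<and> g \<in> carrier G \<and> x = el i g \<and> y = el j g)"
  by (auto simp: geom_def)

lemma order_el: "i \<le> j \<Longrightarrow> j < 3 \<Longrightarrow> g \<in> carrier G \<Longrightarrow> (el i g, el j g) \<in> order_rel geom"
  by (auto simp: geom_def)

lemma incident_geom:
  "incident geom x y \<longleftrightarrow>
     (\<exists>i j g. i < 3 \<and> j < 3 \<and> i \<noteq> j \<and> g \<in> carrier G \<and> x = el i g \<and> y = el j g)"
proof
  assume "incident geom x y"
  then have "x \<noteq> y" "(x, y) \<in> order_rel geom \<or> (y, x) \<in> order_rel geom"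
    by (auto simp: incident_def)
  then show "\<exists>i j g. i < 3 \<and> j < 3 \<and> i \<noteq> j \<and> g \<in> carrier G \<and> x = el i g \<and> y = el j g"
    unfolding order_rel_geom by (metis le_less_trans)
next
  assume "\<exists>i j g. i < 3 \<and> j < 3 \<and> i \<noteq> j \<and> g \<in> carrier G \<and> x = el i g \<and> y = el j g"
  then obtain i j g where *: "i < 3" "j < 3" "i \<noteq> j" "g \<in> carrier G" "x = el i g" "y = el j g"
    by blast
  then have "x \<noteq> y" by (metis el_mod)
  moreover have "(x, y) \<in> order_rel geom \<or> (y, x) \<in> order_rel geom"
    unfolding order_rel_geom using * by (metis nat_le_linear)
  ultimately show "incident geom x y" using * by (auto simp: incident_def)
qed

lemma incident_elE:
  assumes "incident geom (el i g) y" "i < 3"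
  obtains j k where "j < 3" "j \<noteq> i" "k \<in> carrier G" "el i g = el i k" "y = el j k"
proof -
  obtain i' j k where *: "i' < 3" "j < 3" "i' \<noteq> j" "k \<in> carrier G" "el i g = el i' k" "y = el j k"
    using assms(1) unfolding incident_geom by blast
  then have "i' = i" using assms(2) by (metis el_mod)
  then show thesis using * that by blast
qed

lemma incident_el_iff:
  assumes "i < 3" "j < 3" "i \<noteq> j"
  shows "incident geom (el i g) (el j h) \<longleftrightarrow> (\<exists>k\<in>carrier G. el i k = el i g \<and> el j k = el j h)"
proof
  assume "incident geom (el i g) (el j h)"
  then obtain i' j' k where *: "i' < 3" "j' < 3" "k \<in> carrier G" "el i g = el i' k" "el j h = el j' k"
    unfolding incident_geom by blast
  then have "i' = i" "j' = j" using assms by (metis el_mod)+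
  then show "\<exists>k\<in>carrier G. el i k = el i g \<and> el j k = el j h" using * by metis
next
  assume "\<exists>k\<in>carrier G. el i k = el i g \<and> el j k = el j h"
  then show "incident geom (el i g) (el j h)" unfolding incident_geom using assms by metis
qed

lemma incident_el [simp]:
  "i < 3 \<Longrightarrow> j < 3 \<Longrightarrow> i \<noteq> j \<Longrightarrow> g \<in> carrier G \<Longrightarrow> incident geom (el i g) (el j g)"
  by (auto simp: incident_geom)

lemma geom_partial_order: "partial_order_on (carrier geom) (order_rel geom)"
proof -
  have "refl_on (carrier geom) (order_rel geom)"
    unfolding refl_on_def using order_rel_geom carrier_geom by blast
  moreover have "order_rel geom \<subseteq> carrier geom \<times> carrier geom"
    unfolding order_rel_geom[symmetric]
    by (force simp: geom_def)
  moreover have "antisym (order_rel geom)"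
    by (rule antisymI) (metis order_rel_geom el_mod le_antisym le_less_trans)
  moreover have "trans (order_rel geom)"
  proof (rule transI)
    fix x y z assume "(x, y) \<in> order_rel geom" "(y, z) \<in> order_rel geom"
    then obtain i j g j' l h where *: "i \<le> j" "j < 3" "g \<in> carrier G" "x = el i g" "y = el j g"
      "j' \<le> l" "l < 3" "h \<in> carrier G" "y = el j' h" "z = el l h"
      unfolding order_rel_geom by blast
    then have j': "j' = j" by (metis el_mod le_less_trans)
    show "(x, z) \<in> order_rel geom"
    proof (cases "i = j \<or> j = l")
      case True
      have "(el i g, el l g) \<in> order_rel geom" "(el i h, el l h) \<in> order_rel geom"
        using * j' by (auto intro: order_el)
      then show ?thesis using True * j' by auto
    next
      case False
      then have ijl: "i = 0" "j = 1" "l = 2" using * j' by auto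
      then have "g = h \<or> g = s1 \<otimes> (s2 \<otimes> h)" using * j' el1_eq_iff[of g h] by simp
      then obtain k where "k \<in> carrier G" "el 0 k = el 0 g" "el 2 k = el 2 h"
      proof
        assume "g = s1 \<otimes> (s2 \<otimes> h)"
        \<comment> \<open>The two representatives of the edge differ by the involution. The element
          \<open>inv s1 \<otimes> h\<close> lies in the vertex of \<open>g\<close> and in the face
          of \<open>h\<close>, so it witnesses that these two are comparable.\<close>
        then have "el 0 g = el 0 (inv s1 \<otimes> h)" using * by (simp add: el0_tau)
        then show ?thesis using that[of "inv s1 \<otimes> h"] * by simp
      qed (use that * in simp)
      then show ?thesis unfolding order_rel_geom using * ijl
        by (metis One_nat_def Suc_1 lessI numeral_3_eq_3 zero_le)
    qed
  qed
  ultimately show ?thesis by (simp add: partial_order_on_def preorder_on_def)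
qed

section \<open>Flags: a group element gives the vertex and the face, a bit selects one of the two
  edges between them\<close>

fun fl :: "bool \<Rightarrow> 'a \<Rightarrow> nat flag" where
  "fl b g = (el 0 g, el 1 (if b then g else s1 \<otimes> g), el 2 g)"

text \<open>Take representatives \<open>k\<close> and \<open>l\<close> of the edge, \<open>k\<close>
  in the vertex and \<open>l\<close> in the face of \<open>g\<close>. If \<open>l = k\<close>, both
  are \<open>g\<close>. If they differ by the involution, \<open>s2 \<otimes> k\<close> lies in the
  vertex and in the face of \<open>g\<close>, so it is \<open>g\<close>, and the edge is that of
  \<open>inv s2 \<otimes> g\<close>, which is that of \<open>s1 \<otimes> g\<close>.\<close>

lemma edge_between:
  assumes [simp]: "g \<in> carrier G" "h \<in> carrier G"
  shows "incident geom (el 1 h) (el 0 g) \<and> incident geom (el 1 h) (el 2 g) \<longleftrightarrow>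
    el 1 h = el 1 g \<or> el 1 h = el 1 (s1 \<otimes> g)"
proof
  assume "incident geom (el 1 h) (el 0 g) \<and> incident geom (el 1 h) (el 2 g)"
  then obtain k l where k: "k \<in> carrier G" "el 1 k = el 1 h" "el 0 k = el 0 g"
    and l: "l \<in> carrier G" "el 1 l = el 1 h" "el 2 l = el 2 g"
    by (auto simp: incident_el_iff)
  have "l = k \<or> l = s1 \<otimes> (s2 \<otimes> k)" using k l by (metis el1_eq_iff)
  then show "el 1 h = el 1 g \<or> el 1 h = el 1 (s1 \<otimes> g)"
  proof
    assume "l = k"
    then have "k = g" using k l el02_inj by simp
    then show ?thesis using k by simp
  next
    assume "l = s1 \<otimes> (s2 \<otimes> k)"
    then have "s2 \<otimes> k = g" using k l by (intro el02_inj) simp_all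
    then have "k = inv s2 \<otimes> g" using k by auto
    then show ?thesis using k el1_inv_s2[of g] by simp
  qed
next
  assume "el 1 h = el 1 g \<or> el 1 h = el 1 (s1 \<otimes> g)"
  then show "incident geom (el 1 h) (el 0 g) \<and> incident geom (el 1 h) (el 2 g)"
  proof
    assume "el 1 h = el 1 (s1 \<otimes> g)"
    then have "el 1 (inv s2 \<otimes> g) = el 1 h" "el 1 (s1 \<otimes> g) = el 1 h" by (simp_all add: el1_inv_s2)
    moreover have "inv s2 \<otimes> g \<in> carrier G" "s1 \<otimes> g \<in> carrier G" by simp_all
    ultimately show ?thesis
      using el0_inv_s2[of g] el2_s1[of g] assms
      by (auto simp only: incident_el_iff)+
  qed (auto simp: incident_el_iff)
qed

lemma flags_geom: "flags geom = {fl b g | b g. g \<in> carrier G}"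
proof
  show "flags geom \<subseteq> {fl b g | b g. g \<in> carrier G}"
  proof
    fix F assume "F \<in> flags geom"
    then obtain v e f where F: "F = (v, e, f)" "v \<in> elems_of_rank geom 0" "e \<in> elems_of_rank geom 1"
      "f \<in> elems_of_rank geom 2" "incident geom v e" "incident geom e f" "incident geom v f"
      by (auto simp: flags_def)
    then obtain g' h g'' where "g' \<in> carrier G" and h: "h \<in> carrier G" "e = el 1 h" and "g'' \<in> carrier G"
      "v = el 0 g'" "f = el 2 g''" by (auto simp: elems_of_rank_geom)
    then obtain g where g: "g \<in> carrier G" "v = el 0 g" "f = el 2 g"
      using F(7) by (auto simp: incident_el_iff)
    then have "e = el 1 g \<or> e = el 1 (s1 \<otimes> g)"
      using F h edge_between[of g h] by (simp add: incident_sym)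
    then have "F = fl True g \<or> F = fl False g" using F g by auto
    then show "F \<in> {fl b g | b g. g \<in> carrier G}" using g by blast
  qed
next
  have "fl b g \<in> flags geom" if [simp]: "g \<in> carrier G" for b g
    using edge_between[of g "if b then g else s1 \<otimes> g"]
    by (auto simp: flags_def elems_of_rank_geom incident_sym)
  then show "{fl b g | b g. g \<in> carrier G} \<subseteq> flags geom" by blast
qed

lemma fl_eq_iff:
  "g \<in> carrier G \<Longrightarrow> h \<in> carrier G \<Longrightarrow> fl b g = fl c h \<longleftrightarrow> b = c \<and> g = h"
  using el02_inj[of g h] el1_s1_neq[of g] el1_s1_neq[of h] by (auto split: if_splits)

lemma normal_form_inj: "inj_on (\<lambda>(a, b). s1 [^] a \<otimes> s2 [^] b) ({..<p} \<times> {..<q})"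
proof (rule inj_onI, clarsimp)
  fix a b c d assume *: "a < p" "b < q" "c < p" "d < q" "s1 [^] a \<otimes> s2 [^] b = s1 [^] c \<otimes> s2 [^] d"
  \<comment> \<open>The exponents \<open>(p - 1) * c\<close> and \<open>(q - 1) * d\<close> are
    natural-number forms of \<open>- c\<close> and \<open>- d\<close>, so that
    \<open>independent\<close> applies to the quotient of the two normal forms.\<close>
  have "s1 [^] ((p - 1) * c + a) \<otimes> s2 [^] (b + (q - 1) * d) =
      inv (s1 [^] c) \<otimes> (s1 [^] a \<otimes> s2 [^] b) \<otimes> inv (s2 [^] d)"
    unfolding s1_pow_inv s2_pow_inv nat_pow_mult[OF s1, symmetric] nat_pow_mult[OF s2, symmetric]
    by (simp add: m_assoc del: inv_mult_cancel)
  also have "\<dots> = inv (s1 [^] c) \<otimes> (s1 [^] c \<otimes> s2 [^] d) \<otimes> inv (s2 [^] d)" by (simp only: *(5))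
  also have "\<dots> = \<one>" by (simp add: m_assoc)
  finally have "p dvd (p - 1) * c + a" "q dvd b + (q - 1) * d" using independent by blast+
  moreover have "(p - 1) * c + c = p * c" "d + (q - 1) * d = q * d"
    using p3 q3 by (simp_all add: mult_eq_if[of p] mult_eq_if[of q])
  ultimately have "[(p - 1) * c + a = (p - 1) * c + c] (mod p)"
    "[b + (q - 1) * d = d + (q - 1) * d] (mod q)"
    by (simp_all add: cong_def dvd_eq_mod_eq_0)
  then have "[a = c] (mod p)" "[b = d] (mod q)"
    by (simp_all only: cong_add_lcancel_nat cong_add_rcancel_nat)
  then show "a = c \<and> b = d" using * by (simp add: cong_def)
qed

lemma card_flags: "card (flags geom) = 2 * p * q"
proof -
  have "bij_betw (\<lambda>(a, b). s1 [^] a \<otimes> s2 [^] b) ({..<p} \<times> {..<q}) (carrier G)"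
  proof (rule bij_betw_imageI)
    show "inj_on (\<lambda>(a, b). s1 [^] a \<otimes> s2 [^] b) ({..<p} \<times> {..<q})" by (rule normal_form_inj)
  qed (rule carrier_eq[symmetric])
  then have "card (carrier G) = p * q" using bij_betw_same_card by fastforce
  moreover have "flags geom = (\<lambda>(b, g). fl b g) ` (UNIV \<times> carrier G)"
  proof (intro equalityI subsetI)
    fix F assume "F \<in> flags geom"
    then obtain b g where "F = fl b g" "g \<in> carrier G" unfolding flags_geom by blast
    then show "F \<in> (\<lambda>(b, g). fl b g) ` (UNIV \<times> carrier G)"
      by (intro image_eqI[of _ _ "(b, g)"]) (simp_all del: fl.simps)
  next
    fix F assume "F \<in> (\<lambda>(b, g). fl b g) ` (UNIV \<times> carrier G)"
    then obtain b g where "F = fl b g" "g \<in> carrier G" by (auto simp del: fl.simps)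
    then show "F \<in> flags geom" unfolding flags_geom by blast
  qed
  moreover have "inj_on (\<lambda>(b, g). fl b g) (UNIV \<times> carrier G)"
    by (rule inj_onI) (auto simp: fl_eq_iff simp del: fl.simps)
  ultimately show ?thesis by (simp add: card_image card_cartesian_product)
qed

section \<open>Connectedness, the polyhedron axioms and the type\<close>

lemma incident_edge_iff:
  assumes [simp]: "g \<in> carrier G" "h \<in> carrier G" and i: "i \<in> {0, 2}"
  shows "incident geom (el i g) (el 1 h) \<longleftrightarrow> el i g = el i h \<or> el i g = el i (s1 \<otimes> (s2 \<otimes> h))"
proof
  assume "incident geom (el i g) (el 1 h)"
  then obtain k where "k \<in> carrier G" "el i k = el i g" "el 1 k = el 1 h"
    using i incident_el_iff[of i 1 g h] by auto
  then show "el i g = el i h \<or> el i g = el i (s1 \<otimes> (s2 \<otimes> h))"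
    using el1_eq_iff[of k h] by auto
next
  assume "el i g = el i h \<or> el i g = el i (s1 \<otimes> (s2 \<otimes> h))"
  then show "incident geom (el i g) (el 1 h)"
    using i incident_el[of i 1 h] incident_el[of i 1 "s1 \<otimes> (s2 \<otimes> h)"] by auto
qed

lemma geom_connected: "incidence_connected geom (carrier geom)"
proof (rule incidence_connectedI)
  let ?R = "{(a, b). a \<in> carrier geom \<and> b \<in> carrier geom \<and> incident geom a b}"
  have same: "(el i g, el j g) \<in> ?R\<^sup>*" if "i < 3" "j < 3" "g \<in> carrier G" for i j g
    using that by (cases "i = j") (auto intro!: r_into_rtrancl)
  show "el 0 \<one> \<in> carrier geom" by simp
  fix x assume "x \<in> carrier geom"
  then obtain i g where x: "i < 3" "g \<in> carrier G" "x = el i g" by (auto simp: carrier_geom)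
  obtain a b :: nat where g: "g = s1 [^] a \<otimes> s2 [^] b" using generated[OF x(2)] by blast
  have "el 0 \<one> = el 0 (s2 [^] b)" by (rule sym, subst el0_eq_iff) auto
  moreover have "el 2 (s2 [^] b) = el 2 g" unfolding g by (rule sym, subst el2_eq_iff) auto
  ultimately have "(el 0 \<one>, el 2 g) \<in> ?R\<^sup>*" using same[of 0 2 "s2 [^] b"] by simp
  also have "(el 2 g, el i g) \<in> ?R\<^sup>*" using same x by simp
  finally show "(el 0 \<one>, x) \<in> ?R\<^sup>*" using x by simp
qed

text \<open>The elements around the vertex of \<open>g\<close> come from
  \<open>s2 [^] b \<otimes> g\<close>. The edge of \<open>k\<close> is also incident to the face of
  \<open>s2 \<otimes> k\<close>, since \<open>s1 \<otimes> (s2 \<otimes> k)\<close> lies in both; so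
  one walks around the vertex by increasing \<open>b\<close>.\<close>

lemma vertex_link_connected:
  assumes g: "g \<in> carrier G"
  shows "incidence_connected geom {y. incident geom (el 0 g) y}"
proof (rule incidence_connectedI)
  let ?S = "{y. incident geom (el 0 g) y}"
  let ?R = "{(a, b). a \<in> ?S \<and> b \<in> ?S \<and> incident geom a b}"
  have S: "el i (s2 [^] b \<otimes> g) \<in> ?S" if "i \<in> {1, 2}" for i and b :: nat
  proof -
    have "el 0 g = el 0 (s2 [^] b \<otimes> g)" using g by (intro sym[OF el0_eq_iff[THEN iffD2]]) auto
    then show ?thesis using incident_el[of 0 i "s2 [^] b \<otimes> g"] that g by auto
  qed
  have same: "(el i (s2 [^] b \<otimes> g), el j (s2 [^] b \<otimes> g)) \<in> ?R\<^sup>*"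
    if "i \<in> {1, 2}" "j \<in> {1, 2}" for i j and b :: nat
    using that S[of 1 b] S[of 2 b] g by (cases "i = j") (auto intro!: r_into_rtrancl)
  have step: "(el 1 (s2 [^] b \<otimes> g), el 2 (s2 [^] Suc b \<otimes> g)) \<in> ?R\<^sup>*" for b :: nat
  proof -
    let ?k = "s2 [^] b \<otimes> g"
    have "s2 [^] Suc b \<otimes> g = s2 \<otimes> ?k" using g by (simp only: nat_pow_Suc2 s2 m_assoc nat_pow_closed)
    moreover have "incident geom (el 2 (s2 \<otimes> ?k)) (el 1 ?k)"
      using incident_edge_iff[of "s2 \<otimes> ?k" ?k 2] g by simp
    ultimately show ?thesis using S[of 1 b] S[of 2 "Suc b"]
      by (auto intro!: r_into_rtrancl simp: incident_sym)
  qed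
  have conn: "(el 1 g, el 1 (s2 [^] b \<otimes> g)) \<in> ?R\<^sup>*" for b :: nat
  proof (induction b)
    case (Suc b)
    note Suc
    also note step[of b]
    also have "(el 2 (s2 [^] Suc b \<otimes> g), el 1 (s2 [^] Suc b \<otimes> g)) \<in> ?R\<^sup>*" by (rule same) auto
    finally show ?case .
  qed (use g in simp)
  show "el 1 g \<in> ?S" using g by simp
  fix x assume "x \<in> ?S"
  then obtain i k where x: "i < 3" "i \<noteq> 0" "k \<in> carrier G" "el 0 g = el 0 k" "x = el i k"
    using incident_elE[of 0 g x] by auto
  then obtain b :: nat where k: "k = s2 [^] b \<otimes> g" using el0_eq_iff[of k g] g by auto
  note conn[of b]
  also have "(el 1 (s2 [^] b \<otimes> g), el i (s2 [^] b \<otimes> g)) \<in> ?R\<^sup>*" using x by (intro same) auto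
  finally show "(el 1 g, x) \<in> ?R\<^sup>*" using x k by simp
qed

text \<open>The dual walk: the edge of \<open>s1 \<otimes> k\<close> is incident to the vertex of
  \<open>k\<close>, because applying the involution to \<open>s1 \<otimes> k\<close> gives an
  element in the vertex of \<open>k\<close>.\<close>

lemma face_link_connected:
  assumes g: "g \<in> carrier G"
  shows "incidence_connected geom {y. incident geom (el 2 g) y}"
proof (rule incidence_connectedI)
  let ?S = "{y. incident geom (el 2 g) y}"
  let ?R = "{(a, b). a \<in> ?S \<and> b \<in> ?S \<and> incident geom a b}"
  have S: "el i (s1 [^] b \<otimes> g) \<in> ?S" if "i \<in> {0, 1}" for i and b :: nat
  proof -
    have "el 2 g = el 2 (s1 [^] b \<otimes> g)" using g by (intro sym[OF el2_eq_iff[THEN iffD2]]) auto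
    then show ?thesis using incident_el[of 2 i "s1 [^] b \<otimes> g"] that g by auto
  qed
  have same: "(el i (s1 [^] b \<otimes> g), el j (s1 [^] b \<otimes> g)) \<in> ?R\<^sup>*"
    if "i \<in> {0, 1}" "j \<in> {0, 1}" for i j and b :: nat
    using that S[of 0 b] S[of 1 b] g by (cases "i = j") (auto intro!: r_into_rtrancl)
  have step: "(el 0 (s1 [^] b \<otimes> g), el 1 (s1 [^] Suc b \<otimes> g)) \<in> ?R\<^sup>*" for b :: nat
  proof -
    let ?k = "s1 [^] b \<otimes> g"
    have "s1 [^] Suc b \<otimes> g = s1 \<otimes> ?k" using g by (simp only: nat_pow_Suc2 s1 m_assoc nat_pow_closed)
    moreover have "incident geom (el 0 ?k) (el 1 (s1 \<otimes> ?k))"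
      using incident_edge_iff[of ?k "s1 \<otimes> ?k" 0] g by (simp add: el0_tau)
    ultimately show ?thesis using S[of 0 b] S[of 1 "Suc b"]
      by (auto intro!: r_into_rtrancl simp: incident_sym)
  qed
  have conn: "(el 0 g, el 0 (s1 [^] b \<otimes> g)) \<in> ?R\<^sup>*" for b :: nat
  proof (induction b)
    case (Suc b)
    note Suc
    also note step[of b]
    also have "(el 1 (s1 [^] Suc b \<otimes> g), el 0 (s1 [^] Suc b \<otimes> g)) \<in> ?R\<^sup>*" by (rule same) auto
    finally show ?case .
  qed (use g in simp)
  show "el 0 g \<in> ?S" using g by simp
  fix x assume "x \<in> ?S"
  then obtain i k where x: "i < 3" "i \<noteq> 2" "k \<in> carrier G" "el 2 g = el 2 k" "x = el i k"
    using incident_elE[of 2 g x] by auto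
  then obtain b :: nat where k: "k = s1 [^] b \<otimes> g" using el2_eq_iff[of k g] g by auto
  note conn[of b]
  also have "(el 0 (s1 [^] b \<otimes> g), el i (s1 [^] b \<otimes> g)) \<in> ?R\<^sup>*" using x by (intro same) auto
  finally show "(el 0 g, x) \<in> ?R\<^sup>*" using x k by simp
qed

lemma polyhedron_geom: "polyhedron geom"
  unfolding polyhedron_def
proof (intro conjI ballI allI impI)
  show "partial_order_on (carrier geom) (order_rel geom)" by (rule geom_partial_order)
  show "incidence_connected geom (carrier geom)" by (rule geom_connected)
next
  fix x assume "x \<in> carrier geom"
  then show "rank_of geom x \<in> {0, 1, 2}" by (auto simp: geom_def)
next
  fix x y assume "(x, y) \<in> order_rel geom \<and> x \<noteq> y"
  then obtain i j g where "i \<le> j" "j < 3" "x = el i g" "y = el j g" "x \<noteq> y"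
    unfolding order_rel_geom by blast
  then show "rank_of geom x < rank_of geom y" by (cases "i = j") (auto simp: geom_def)
next
  fix e assume "e \<in> elems_of_rank geom 1"
  then obtain h where h: "h \<in> carrier G" "e = el 1 h" by (auto simp: elems_of_rank_geom)
  have "{v \<in> elems_of_rank geom i. incident geom v e} = {el i h, el i (s1 \<otimes> (s2 \<otimes> h))}"
    if "i \<in> {0, 2}" for i
  proof -
    have "i < 3" using that by auto
    then show ?thesis
      using incident_edge_iff[OF _ h(1) that] h by (auto simp: elems_of_rank_geom)
  qed
  then show "card {v \<in> elems_of_rank geom 0. incident geom v e} = 2"
    "card {v \<in> elems_of_rank geom 2. incident geom v e} = 2"
    using el0_tau_neq[OF h(1)] el2_tau_neq[OF h(1)] by (auto simp del: el2_s1)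
next
  fix v f assume "v \<in> elems_of_rank geom 0" "f \<in> elems_of_rank geom 2" "incident geom v f"
  then obtain g where g: "g \<in> carrier G" "v = el 0 g" "f = el 2 g"
    by (auto simp: elems_of_rank_geom incident_el_iff)
  have "incident geom (el 1 (s1 \<otimes> g)) v" "incident geom (el 1 (s1 \<otimes> g)) f"
    using edge_between[of g "s1 \<otimes> g"] g by auto
  then have "{e \<in> elems_of_rank geom 1. incident geom e v \<and> incident geom e f} = {el 1 g, el 1 (s1 \<otimes> g)}"
    using edge_between[OF g(1)] g by (auto simp: elems_of_rank_geom)
  then show "card {e \<in> elems_of_rank geom 1. incident geom e v \<and> incident geom e f} = 2"
    using el1_s1_neq[OF g(1)] by auto
next
  fix x assume "x \<in> elems_of_rank geom 0 \<union> elems_of_rank geom 2"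
  then show "incidence_connected geom {y. incident geom x y}"
    using vertex_link_connected face_link_connected by (auto simp: elems_of_rank_geom)
qed

text \<open>The edges of the face of \<open>g\<close> are those of
  \<open>s1 [^] a \<otimes> g\<close> with \<open>a < p\<close>. No two coincide, as
  \<open>s1 \<otimes> s2\<close> is not a power of \<open>s1\<close>. Vertices are treated in the
  same way with \<open>s2\<close>.\<close>

lemma has_type_geom: "has_type geom p q"
  unfolding has_type_def
proof (intro conjI ballI)
  fix f assume "f \<in> elems_of_rank geom 2"
  then obtain g where g: "g \<in> carrier G" "f = el 2 g" by (auto simp: elems_of_rank_geom)
  have "{e \<in> elems_of_rank geom 1. incident geom e f} = (\<lambda>a. el 1 (s1 [^] a \<otimes> g)) ` {..<p}"
  proof (intro equalityI subsetI)
    fix e assume "e \<in> {e \<in> elems_of_rank geom 1. incident geom e f}"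
    then obtain k where k: "k \<in> carrier G" "e = el 1 k" "el 2 k = el 2 g"
      using g by (auto simp: elems_of_rank_geom incident_el_iff)
    then obtain a :: nat where "k = s1 [^] a \<otimes> g" using el2_eq_iff[of k g] g by auto
    then have "e = el 1 (s1 [^] (a mod p) \<otimes> g)" using k s1_pow_mod by simp
    then show "e \<in> (\<lambda>a. el 1 (s1 [^] a \<otimes> g)) ` {..<p}" using p3 by simp
  next
    fix e assume "e \<in> (\<lambda>a. el 1 (s1 [^] a \<otimes> g)) ` {..<p}"
    then obtain a :: nat where a: "e = el 1 (s1 [^] a \<otimes> g)" by auto
    have "el 2 g = el 2 (s1 [^] a \<otimes> g)" using g by (intro sym[OF el2_eq_iff[THEN iffD2]]) auto
    then show "e \<in> {e \<in> elems_of_rank geom 1. incident geom e f}"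
      using g a by (simp add: elems_of_rank_geom)
  qed
  moreover have "inj_on (\<lambda>a. el 1 (s1 [^] a \<otimes> g)) {..<p}"
  proof (rule inj_onI)
    fix a b assume ab: "a \<in> {..<p}" "b \<in> {..<p}" "el 1 (s1 [^] a \<otimes> g) = el 1 (s1 [^] b \<otimes> g)"
    then have "s1 [^] a \<otimes> g = s1 [^] b \<otimes> g \<or> s1 [^] a \<otimes> g = (s1 \<otimes> s2 \<otimes> s1 [^] b) \<otimes> g"
      using el1_eq_iff[of "s1 [^] a \<otimes> g" "s1 [^] b \<otimes> g"] g by (simp add: m_assoc)
    then have "s1 [^] a = s1 [^] b \<or> s1 [^] a = s1 \<otimes> s2 \<otimes> s1 [^] b" using g by simp
    then have "s1 [^] a = s1 [^] b \<or> s1 [^] a \<otimes> inv (s1 [^] b) = s1 \<otimes> s2"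
      by (auto simp: m_assoc)
    then have "s1 [^] a = s1 [^] b"
      using tau_not_s1_power[of "a + (p - 1) * b"] by (simp add: s1_pow_inv nat_pow_mult)
    then have "fst (a, 0::nat) = fst (b, 0::nat)"
      using ab q3 by (intro arg_cong[where f = fst] inj_onD[OF normal_form_inj]) auto
    then show "a = b" by simp
  qed
  ultimately show "card {e \<in> elems_of_rank geom 1. incident geom e f} = p"
    by (simp add: card_image)
next
  fix v assume "v \<in> elems_of_rank geom 0"
  then obtain g where g: "g \<in> carrier G" "v = el 0 g" by (auto simp: elems_of_rank_geom)
  have "{e \<in> elems_of_rank geom 1. incident geom e v} = (\<lambda>a. el 1 (s2 [^] a \<otimes> g)) ` {..<q}"
  proof (intro equalityI subsetI)
    fix e assume "e \<in> {e \<in> elems_of_rank geom 1. incident geom e v}"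
    then obtain k where k: "k \<in> carrier G" "e = el 1 k" "el 0 k = el 0 g"
      using g by (auto simp: elems_of_rank_geom incident_el_iff)
    then obtain a :: nat where "k = s2 [^] a \<otimes> g" using el0_eq_iff[of k g] g by auto
    then have "e = el 1 (s2 [^] (a mod q) \<otimes> g)" using k s2_pow_mod by simp
    then show "e \<in> (\<lambda>a. el 1 (s2 [^] a \<otimes> g)) ` {..<q}" using q3 by simp
  next
    fix e assume "e \<in> (\<lambda>a. el 1 (s2 [^] a \<otimes> g)) ` {..<q}"
    then obtain a :: nat where a: "e = el 1 (s2 [^] a \<otimes> g)" by auto
    have "el 0 g = el 0 (s2 [^] a \<otimes> g)" using g by (intro sym[OF el0_eq_iff[THEN iffD2]]) auto
    then show "e \<in> {e \<in> elems_of_rank geom 1. incident geom e v}"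
      using g a by (simp add: elems_of_rank_geom)
  qed
  moreover have "inj_on (\<lambda>a. el 1 (s2 [^] a \<otimes> g)) {..<q}"
  proof (rule inj_onI)
    fix a b assume ab: "a \<in> {..<q}" "b \<in> {..<q}" "el 1 (s2 [^] a \<otimes> g) = el 1 (s2 [^] b \<otimes> g)"
    then have "s2 [^] a \<otimes> g = s2 [^] b \<otimes> g \<or> s2 [^] a \<otimes> g = (s1 \<otimes> s2 \<otimes> s2 [^] b) \<otimes> g"
      using el1_eq_iff[of "s2 [^] a \<otimes> g" "s2 [^] b \<otimes> g"] g by (simp add: m_assoc)
    then have "s2 [^] a = s2 [^] b \<or> s2 [^] a = s1 \<otimes> s2 \<otimes> s2 [^] b" using g by simp
    then have "s2 [^] a = s2 [^] b \<or> s2 [^] a \<otimes> inv (s2 [^] b) = s1 \<otimes> s2"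
      by (auto simp: m_assoc)
    then have "s2 [^] a = s2 [^] b"
      using tau_not_s2_power[of "a + (q - 1) * b"] by (simp add: s2_pow_inv nat_pow_mult)
    then have "snd (0::nat, a) = snd (0::nat, b)"
      using ab p3 by (intro arg_cong[where f = snd] inj_onD[OF normal_form_inj]) auto
    then show "a = b" by simp
  qed
  ultimately show "card {e \<in> elems_of_rank geom 1. incident geom e v} = q"
    by (simp add: card_image)
qed

section \<open>Adjacent flags and their transport by automorphisms\<close>

definition nbr :: "nat \<Rightarrow> bool \<Rightarrow> 'a \<Rightarrow> 'a" where
  "nbr i b g = (if i = 1 then g else if i = 0 then (if b then inv s1 \<otimes> g else s1 \<otimes> g)
     else (if b then s2 \<otimes> g else inv s2 \<otimes> g))"

lemma nbr_closed [simp]: "g \<in> carrier G \<Longrightarrow> nbr i b g \<in> carrier G"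
  by (simp add: nbr_def)

lemma el12_eq_iff:
  "g \<in> carrier G \<Longrightarrow> h \<in> carrier G \<Longrightarrow> el 1 g = el 1 h \<and> el 2 g = el 2 h \<longleftrightarrow> g = h"
  using el1_eq_iff[of g h] el2_tau_neq[of h] by auto

lemma el10_eq_iff:
  "g \<in> carrier G \<Longrightarrow> h \<in> carrier G \<Longrightarrow> el 1 g = el 1 h \<and> el 0 g = el 0 h \<longleftrightarrow> g = h"
  using el1_eq_iff[of g h] el0_tau_neq[of h] by auto

text \<open>Passing to an adjacent flag always flips the bit, so the bit distinguishes the two
  classes of flags; \<open>nbr\<close> tells how the group element changes.\<close>

lemma adjacent_fl_iff:
  assumes [simp]: "g \<in> carrier G" "k \<in> carrier G" and i: "i \<in> {0, 1, 2}"
  shows "adjacent_flags i (fl b g) (fl c k) \<longleftrightarrow> c = (\<not> b) \<and> k = nbr i b g"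
proof -
  \<comment> \<open>Both \<open>?x\<close> and \<open>?x'\<close> represent the edge of the first
    flag, \<open>?x\<close> inside its face and \<open>?x'\<close> inside its vertex. An edge and
    one of its faces, or an edge and one of its vertices, share exactly one group element, so
    sharing two entries becomes an equation in \<open>G\<close>.\<close>
  let ?x = "if b then g else s1 \<otimes> g" and ?x' = "if b then g else inv s2 \<otimes> g"
  let ?y = "if c then k else s1 \<otimes> k" and ?y' = "if c then k else inv s2 \<otimes> k"
  have eqs: "el 1 ?x' = el 1 ?x" "el 1 ?y' = el 1 ?y" "el 2 ?x = el 2 g" "el 2 ?y = el 2 k"
    "el 0 ?x' = el 0 g" "el 0 ?y' = el 0 k"
    by (simp_all add: el1_inv_s2)
  have cl: "?x \<in> carrier G" "?y \<in> carrier G" "?x' \<in> carrier G" "?y' \<in> carrier G" by simp_all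
  consider "i = 0" | "i = 1" | "i = 2" using i by blast
  then show ?thesis
  proof cases
    case 1
    have "el 1 ?y = el 1 ?x \<and> el 2 k = el 2 g \<longleftrightarrow> ?y = ?x"
      using el12_eq_iff[OF cl(2,1)] unfolding eqs .
    then have "adjacent_flags i (fl b g) (fl c k) \<longleftrightarrow> ?y = ?x \<and> el 0 k \<noteq> el 0 g"
      unfolding adjacent_flags_def using 1 by auto
    also have "\<dots> \<longleftrightarrow> c = (\<not> b) \<and> k = nbr i b g"
      using 1 el0_tau_neq[of g] el0_tau[of g] el0_tau_neq[of k] el0_tau[of k] by (auto simp: nbr_def)
    finally show ?thesis .
  next
    case 2
    have "el 0 k = el 0 g \<and> el 2 k = el 2 g \<longleftrightarrow> k = g" using el02_inj[of k g] by auto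
    then have "adjacent_flags i (fl b g) (fl c k) \<longleftrightarrow> k = g \<and> el 1 ?y \<noteq> el 1 ?x"
      unfolding adjacent_flags_def using 2 by auto
    also have "\<dots> \<longleftrightarrow> c = (\<not> b) \<and> k = nbr i b g"
      using 2 el1_s1_neq[of g] by (auto simp: nbr_def)
    finally show ?thesis .
  next
    case 3
    have "el 1 ?y = el 1 ?x \<and> el 0 k = el 0 g \<longleftrightarrow> ?y' = ?x'"
      using el10_eq_iff[OF cl(4,3)] unfolding eqs .
    then have "adjacent_flags i (fl b g) (fl c k) \<longleftrightarrow> ?y' = ?x' \<and> el 2 k \<noteq> el 2 g"
      unfolding adjacent_flags_def using 3 by auto
    also have "\<dots> \<longleftrightarrow> c = (\<not> b) \<and> k = nbr i b g"
      using 3 el2_tau_neq[of g] el2_tau_neq[of k] by (auto simp: nbr_def)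
    finally show ?thesis .
  qed
qed

lemma fl_in_flags: "g \<in> carrier G \<Longrightarrow> fl b g \<in> flags geom"
  unfolding flags_geom by blast

lemma flag_adj_fl:
  assumes "g \<in> carrier G" "i \<in> {0, 1, 2}"
  shows "flag_adj geom i (fl b g) = fl (\<not> b) (nbr i b g)"
  unfolding flag_adj_def adjacent_flags_def[symmetric]
proof (rule the_equality)
  show "fl (\<not> b) (nbr i b g) \<in> flags geom \<and> adjacent_flags i (fl b g) (fl (\<not> b) (nbr i b g))"
    using adjacent_fl_iff[OF assms(1) nbr_closed[OF assms(1)] assms(2)]
      fl_in_flags[OF nbr_closed[OF assms(1)]] by blast
  fix F assume F: "F \<in> flags geom \<and> adjacent_flags i (fl b g) F"
  then obtain c k where ck: "F = fl c k" "k \<in> carrier G" unfolding flags_geom by blast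
  then have "c = (\<not> b) \<and> k = nbr i b g"
    using F adjacent_fl_iff[OF assms(1) ck(2) assms(2)] by (simp del: fl.simps)
  then show "F = fl (\<not> b) (nbr i b g)" using ck(1) by (simp del: fl.simps)
qed

lemma flag_adj_closed:
  assumes "F \<in> flags geom" "i \<in> {0, 1, 2}" shows "flag_adj geom i F \<in> flags geom"
proof -
  obtain b g where "F = fl b g" "g \<in> carrier G" using assms unfolding flags_geom by blast
  then show ?thesis using flag_adj_fl[of g i b] fl_in_flags[of "nbr i b g"] assms(2)
    by (simp del: fl.simps)
qed

lemma flag_adj_eqI:
  assumes "F \<in> flags geom" "F' \<in> flags geom" "i \<in> {0, 1, 2}" "adjacent_flags i F F'"
  shows "flag_adj geom i F = F'"
proof -
  obtain b g c k where "F = fl b g" "g \<in> carrier G" "F' = fl c k" "k \<in> carrier G"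
    using assms unfolding flags_geom by blast
  then show ?thesis using flag_adj_fl[of g i b] adjacent_fl_iff[of g k i b c] assms(3,4)
    by (simp del: fl.simps)
qed

lemma flag_adj_adjacent:
  assumes "F \<in> flags geom" "i \<in> {0, 1, 2}"
  shows "adjacent_flags i F (flag_adj geom i F)"
proof -
  obtain b g where "F = fl b g" "g \<in> carrier G"
    using assms unfolding flags_geom by blast
  then show ?thesis using flag_adj_fl[of g i b] adjacent_fl_iff[of g "nbr i b g" i b "\<not> b"] assms(2)
    by (simp del: fl.simps)
qed

text \<open>Automorphisms preserve flags and are injective, so they preserve which entries of two
  flags differ; adjacent flags are unique.\<close>

lemma aut_flag_adj:
  assumes h: "h \<in> carrier (poset_aut_group geom)" and F: "F \<in> flags geom" and i: "i \<in> {0, 1, 2}"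
  shows "map_flag h (flag_adj geom i F) = flag_adj geom i (map_flag h F)"
proof (rule sym, rule flag_adj_eqI)
  have F': "flag_adj geom i F \<in> flags geom" using F i by (rule flag_adj_closed)
  show "map_flag h F \<in> flags geom" "map_flag h (flag_adj geom i F) \<in> flags geom"
    using map_flag_aut[OF polyhedron_geom h] F F' by auto
  have "inj_on h (carrier geom)" using h by (auto simp: poset_aut_group_def Bij_def bij_betw_def)
  moreover have "flag_elem F'' j \<in> carrier geom" if "F'' \<in> flags geom" for F'' j
    using that by (auto simp: flags_def elems_of_rank_def)
  moreover have "flag_elem (map_flag h F'') j = h (flag_elem F'' j)" for F'' j
    by (cases F'') auto
  ultimately show "adjacent_flags i (map_flag h F) (map_flag h (flag_adj geom i F))"
    using flag_adj_adjacent[OF F i] F F' by (simp add: adjacent_flags_def inj_on_eq_iff)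
qed (rule i)

text \<open>The same moves multiply by the generators in one class and by their inverses in the
  other. This asymmetry is what chirality is tested against.\<close>

lemma flag_adj_generators:
  assumes "g \<in> carrier G"
  shows "flag_adj geom 0 (flag_adj geom 1 (fl b g)) = fl b (if b then s1 \<otimes> g else inv s1 \<otimes> g)"
    and "flag_adj geom 1 (flag_adj geom 2 (fl b g)) = fl b (if b then s2 \<otimes> g else inv s2 \<otimes> g)"
  using assms by (simp_all add: flag_adj_fl nbr_def del: fl.simps)

lemma aut_generators:
  assumes h: "h \<in> carrier (poset_aut_group geom)" and "g \<in> carrier G" "k \<in> carrier G"
    and eq: "map_flag h (fl True g) = fl b k"
  shows "map_flag h (fl True (s1 \<otimes> g)) = fl b (if b then s1 \<otimes> k else inv s1 \<otimes> k)"
    and "map_flag h (fl True (s2 \<otimes> g)) = fl b (if b then s2 \<otimes> k else inv s2 \<otimes> k)"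
proof -
  have F: "fl True g \<in> flags geom" using assms fl_in_flags by blast
  have adj: "map_flag h (flag_adj geom i (flag_adj geom j (fl True g))) =
      flag_adj geom i (flag_adj geom j (fl b k))" if "i \<in> {0, 1, 2}" "j \<in> {0, 1, 2}" for i j
    using aut_flag_adj[OF h F that(2)] aut_flag_adj[OF h flag_adj_closed[OF F that(2)] that(1)] eq by simp
  from adj[of 0 1] adj[of 1 2] assms
  show "map_flag h (fl True (s1 \<otimes> g)) = fl b (if b then s1 \<otimes> k else inv s1 \<otimes> k)"
    "map_flag h (fl True (s2 \<otimes> g)) = fl b (if b then s2 \<otimes> k else inv s2 \<otimes> k)"
    unfolding flag_adj_generators[OF \<open>g \<in> carrier G\<close>] flag_adj_generators[OF \<open>k \<in> carrier G\<close>]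
    by (simp_all del: fl.simps map_flag.simps)
qed

section \<open>Right multiplications as automorphisms, and class-reversing automorphisms\<close>

lemma generated_induct [consumes 1, case_names one s1 s2]:
  assumes "g \<in> carrier G" and "Q \<one>"
    and Q1: "\<And>g. g \<in> carrier G \<Longrightarrow> Q g \<Longrightarrow> Q (s1 \<otimes> g)"
    and Q2: "\<And>g. g \<in> carrier G \<Longrightarrow> Q g \<Longrightarrow> Q (s2 \<otimes> g)"
  shows "Q g"
proof -
  obtain a b :: nat where g: "g = s1 [^] a \<otimes> s2 [^] b" using generated[OF assms(1)] by blast
  have b: "Q (s2 [^] b)"
  proof (induction b)
    case (Suc b)
    have "s2 [^] Suc b = s2 \<otimes> s2 [^] b" by (rule nat_pow_Suc2) simp
    then show ?case using Q2 Suc by simp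
  qed (simp add: \<open>Q \<one>\<close>)
  have "Q (s1 [^] a \<otimes> s2 [^] b)"
  proof (induction a)
    case (Suc a)
    have "s1 [^] Suc a = s1 \<otimes> s1 [^] a" by (rule nat_pow_Suc2) simp
    then have "s1 [^] Suc a \<otimes> s2 [^] b = s1 \<otimes> (s1 [^] a \<otimes> s2 [^] b)" by (simp add: m_assoc)
    then show ?case using Q1[OF _ Suc] by simp
  qed (simp add: b)
  then show ?thesis unfolding g .
qed

text \<open>Right multiplication of cosets by \<open>g\<close>. The choice of the representative
  \<open>k\<close> does not matter, by \<open>el_mult_right\<close>. The map is restricted to the
  carrier because elements of \<open>Bij\<close> are extensional.\<close>

definition act :: "'a \<Rightarrow> nat \<Rightarrow> nat" where
  "act g = (\<lambda>x\<in>carrier geom. el (x mod 3) ((SOME k. k \<in> carrier G \<and> el (x mod 3) k = x) \<otimes> g))"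

lemma el_mult_right:
  assumes [simp]: "g \<in> carrier G" "k \<in> carrier G" "l \<in> carrier G" and i: "i < 3" and eq: "el i k = el i l"
  shows "el i (k \<otimes> g) = el i (l \<otimes> g)"
proof -
  consider "i = 0" | "i = 1" | "i = 2" using i by linarith
  then show ?thesis
  proof cases
    case 1 then show ?thesis using eq by (auto simp: el0_eq_iff m_assoc)
  next
    case 2 then show ?thesis using eq by (auto simp: el1_eq_iff m_assoc)
  next
    case 3 then show ?thesis using eq by (auto simp: el2_eq_iff m_assoc)
  qed
qed

lemma act_el:
  assumes "g \<in> carrier G" "k \<in> carrier G" "i < 3"
  shows "act g (el i k) = el i (k \<otimes> g)"
proof -
  let ?l = "SOME l. l \<in> carrier G \<and> el i l = el i k"
  have "?l \<in> carrier G \<and> el i ?l = el i k" by (rule someI[of _ k]) (use assms in simp)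
  then show ?thesis using assms el_mult_right[of g ?l k i] by (simp add: act_def)
qed

lemma act_fl: "g \<in> carrier G \<Longrightarrow> k \<in> carrier G \<Longrightarrow> map_flag (act g) (fl b k) = fl b (k \<otimes> g)"
  by (simp add: act_el m_assoc)

lemma act_extensional: "act g \<in> extensional (carrier geom)"
  by (simp add: act_def)

lemma act_mult:
  assumes "g \<in> carrier G" "h \<in> carrier G"
  shows "act (g \<otimes> h) = compose (carrier geom) (act h) (act g)"
proof (rule extensionalityI[OF act_extensional compose_extensional])
  fix x assume x: "x \<in> carrier geom"
  then obtain i k where "i < 3" "k \<in> carrier G" "x = el i k" unfolding carrier_geom by blast
  then show "act (g \<otimes> h) x = compose (carrier geom) (act h) (act g) x"
    using assms x by (simp add: compose_eq act_el m_assoc)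
qed

lemma act_aut:
  assumes g: "g \<in> carrier G"
  shows "act g \<in> carrier (poset_aut_group geom)"
proof -
  have act_carrier: "act h x \<in> carrier geom" if "h \<in> carrier G" "x \<in> carrier geom" for h x
    using that unfolding carrier_geom by (metis act_el m_closed)
  have act_inv: "act (inv h) (act h x) = x" if "h \<in> carrier G" "x \<in> carrier geom" for h x
    using that by (auto simp: carrier_geom act_el m_assoc)
  have act_order: "(act h x, act h y) \<in> order_rel geom" 
    if h: "h \<in> carrier G" and xy: "(x, y) \<in> order_rel geom" for h x y
  proof -
    obtain i j k where "i \<le> j" "j < 3" "k \<in> carrier G" "x = el i k" "y = el j k"
      using xy unfolding order_rel_geom by blast
    then show ?thesis using h by (simp add: act_el order_el)
  qed
  have "bij_betw (act g) (carrier geom) (carrier geom)"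
    by (rule bij_betw_byWitness[where f' = "act (inv g)"])
      (use act_carrier act_inv[of g] act_inv[of "inv g"] g in auto)
  moreover have "(x, y) \<in> order_rel geom"
    if "x \<in> carrier geom" "y \<in> carrier geom" "(act g x, act g y) \<in> order_rel geom" for x y
    using act_order[OF inv_closed[OF g] that(3)] that g by (simp add: act_inv)
  ultimately show ?thesis
    using act_order g act_extensional by (auto simp: poset_aut_group_def Bij_def)
qed

text \<open>The image of one flag determines an automorphism: left multiplication by the generators
  is a move to nearby flags, which automorphisms respect, so agreement with \<open>act g\<close>
  spreads from the base flag to all flags of its class.\<close>

lemma aut_eq_act:
  assumes h: "h \<in> carrier (poset_aut_group geom)" and g: "g \<in> carrier G"
    and eq: "map_flag h (fl True \<one>) = fl True g"
  shows "h = act g"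
proof (rule extensionalityI[OF _ act_extensional])
  show "h \<in> extensional (carrier geom)" using h by (auto simp: poset_aut_group_def Bij_def)
  fix x assume "x \<in> carrier geom"
  then obtain i k where x: "i < 3" "k \<in> carrier G" "x = el i k" unfolding carrier_geom by blast
  from x(2) have "map_flag h (fl True k) = fl True (k \<otimes> g)"
  proof (induction rule: generated_induct)
    case (s1 k)
    then show ?case using aut_generators(1)[OF h s1(1) _ s1(2)] g by (simp add: m_assoc)
  next
    case (s2 k)
    then show ?case using aut_generators(2)[OF h s2(1) _ s2(2)] g by (simp add: m_assoc)
  qed (use eq g in simp)
  moreover have "i = 0 \<or> i = 1 \<or> i = 2" using x by auto
  ultimately show "h x = act g x" using x g by (auto simp: act_el)
qed

text \<open>Here \<theta> records the group element of the image flag. The base class is multiplied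
  by generators and the other class by their inverses, hence the inverses in the conclusion.\<close>

lemma aut_reversing:
  assumes h: "h \<in> carrier (poset_aut_group geom)" and g: "g \<in> carrier G"
    and eq: "map_flag h (fl True \<one>) = fl False g"
  obtains \<theta> where "\<And>k. k \<in> carrier G \<Longrightarrow> \<theta> k \<in> carrier G"
    "\<And>k. k \<in> carrier G \<Longrightarrow> \<theta> (s1 \<otimes> k) = inv s1 \<otimes> \<theta> k"
    "\<And>k. k \<in> carrier G \<Longrightarrow> \<theta> (s2 \<otimes> k) = inv s2 \<otimes> \<theta> k"
proof -
  have "\<exists>l\<in>carrier G. map_flag h (fl True k) = fl False l" if "k \<in> carrier G" for k
    using that
  proof (induction rule: generated_induct)
    case (s1 k)
    then obtain l where l: "l \<in> carrier G" "map_flag h (fl True k) = fl False l" by blast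
    then show ?case using aut_generators(1)[OF h s1(1) l]
      by (intro bexI[of _ "inv s1 \<otimes> l"]) (simp_all del: fl.simps)
  next
    case (s2 k)
    then obtain l where l: "l \<in> carrier G" "map_flag h (fl True k) = fl False l" by blast
    then show ?case using aut_generators(2)[OF h s2(1) l]
      by (intro bexI[of _ "inv s2 \<otimes> l"]) (simp_all del: fl.simps)
  qed (use eq g in blast)
  then obtain \<theta> where \<theta>: "\<theta> k \<in> carrier G" "map_flag h (fl True k) = fl False (\<theta> k)"
    if "k \<in> carrier G" for k by metis
  have fl_inj: "k = l" if "fl False k = fl False l" "k \<in> carrier G" "l \<in> carrier G" for k l
    using that fl_eq_iff by blast
  have "\<theta> (s1 \<otimes> k) = inv s1 \<otimes> \<theta> k" "\<theta> (s2 \<otimes> k) = inv s2 \<otimes> \<theta> k" if k: "k \<in> carrier G" for k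
    using aut_generators[OF h k \<theta>[OF k]] \<theta>[of "s1 \<otimes> k"] \<theta>[of "s2 \<otimes> k"] k \<theta>(1)[OF k]
      fl_inj[of "\<theta> (s1 \<otimes> k)" "inv s1 \<otimes> \<theta> k"] fl_inj[of "\<theta> (s2 \<otimes> k)" "inv s2 \<otimes> \<theta> k"]
    by (simp_all del: fl.simps map_flag.simps)
  then show thesis using that \<theta>(1) by blast
qed

text \<open>The hypothesis excludes automorphisms that exchange the two classes. What remains are
  the maps \<open>act g\<close>, which are transitive on each class and form a copy of
  \<open>G\<close>.\<close>

theorem is_aut_group_of_tight_chiral_polyhedron:
  assumes chiral: "\<And>\<theta>. (\<And>k. k \<in> carrier G \<Longrightarrow> \<theta> k \<in> carrier G) \<Longrightarrow>
      (\<And>k. k \<in> carrier G \<Longrightarrow> \<theta> (s1 \<otimes> k) = inv s1 \<otimes> \<theta> k) \<Longrightarrow>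
      (\<And>k. k \<in> carrier G \<Longrightarrow> \<theta> (s2 \<otimes> k) = inv s2 \<otimes> \<theta> k) \<Longrightarrow> False"
  shows "is_aut_group_of_tight_chiral_polyhedron G s1 s2 p q"
proof -
  have not_reversing: "map_flag h (fl True \<one>) \<noteq> fl False g"
    if "h \<in> carrier (poset_aut_group geom)" "g \<in> carrier G" for h g
    using that chiral aut_reversing by metis
  define C where "C b = {fl b g | g. g \<in> carrier G}" for b
  have trans: "aut_transitive_on geom (C b)" for b
    unfolding aut_transitive_on_def
  proof (intro ballI)
    fix F F' assume "F \<in> C b" "F' \<in> C b"
    then obtain g k where gk: "g \<in> carrier G" "k \<in> carrier G" "F = fl b g" "F' = fl b k"
      unfolding C_def by blast
    then have "map_flag (act (inv g \<otimes> k)) F = F'"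
      using act_fl[of "inv g \<otimes> k" g b] by (simp del: fl.simps)
    then show "\<exists>h\<in>carrier (poset_aut_group geom). map_flag h F = F'"
      using gk act_aut[of "inv g \<otimes> k"] by blast
  qed
  have "chiral geom"
    unfolding chiral_def
  proof (intro conjI, rule polyhedron_geom, rule exI[of _ "C True"], rule exI[of _ "C False"], intro conjI)
    show "flags geom = C True \<union> C False"
    proof -
      have "{fl b g | b g. g \<in> carrier G} = (\<Union>b. {fl b g | g. g \<in> carrier G})" by blast
      then show ?thesis by (simp only: flags_geom C_def UNIV_bool) blast
    qed
    show "C True \<inter> C False = {}" unfolding C_def using fl_eq_iff by blast
    show "\<forall>F\<in>flags geom. \<forall>i\<in>{0, 1, 2}. (flag_adj geom i F \<in> C True) = (F \<in> C False)"
    proof (intro ballI)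
      fix F and i :: nat assume F: "F \<in> flags geom" and i: "i \<in> {0, 1, 2}"
      obtain b g where bg: "F = fl b g" "g \<in> carrier G" using F unfolding flags_geom by blast
      have mem: "fl c k \<in> C d \<longleftrightarrow> c = d" if "k \<in> carrier G" for c d k
        using that by (auto simp: C_def fl_eq_iff simp del: fl.simps)
      show "(flag_adj geom i F \<in> C True) = (F \<in> C False)"
        using bg i by (simp add: flag_adj_fl mem del: fl.simps)
    qed
    show "\<not> aut_transitive_on geom (flags geom)"
    proof
      assume "aut_transitive_on geom (flags geom)"
      then obtain h where "h \<in> carrier (poset_aut_group geom)" "map_flag h (fl True \<one>) = fl False \<one>"
        unfolding aut_transitive_on_def using fl_in_flags by blast
      then show False using not_reversing by blast
    qed
  qed (rule trans)+
  moreover have "is_aut_group_with_gens G s1 s2 geom"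
    unfolding is_aut_group_with_gens_def
  proof (intro bexI[of _ "fl True \<one>"] bexI[of _ act] conjI)
    show "map_flag (act s1) (fl True \<one>) = flag_adj geom 0 (flag_adj geom 1 (fl True \<one>))"
      "map_flag (act s2) (fl True \<one>) = flag_adj geom 1 (flag_adj geom 2 (fl True \<one>))"
      using flag_adj_generators[of \<one> True] act_fl[of s1 \<one> True] act_fl[of s2 \<one> True]
      by (simp_all del: fl.simps)
    show "fl True \<one> \<in> flags geom" by (rule fl_in_flags) simp
    have "act \<in> hom G (poset_aut_group geom)"
      using act_aut act_mult by (auto simp: hom_def) (simp add: poset_aut_group_def)
    moreover have "bij_betw act (carrier G) (carrier (poset_aut_group geom))"
    proof (rule bij_betw_imageI)
      show "inj_on act (carrier G)"
      proof (rule inj_onI)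
        fix g h assume "g \<in> carrier G" "h \<in> carrier G" "act g = act h"
        then have "fl True g = fl True h" using act_fl[of g \<one> True] act_fl[of h \<one> True] by simp
        then show "g = h" using \<open>g \<in> carrier G\<close> \<open>h \<in> carrier G\<close> fl_eq_iff by blast
      qed
      show "act ` carrier G = carrier (poset_aut_group geom)"
      proof (intro equalityI subsetI)
        fix h assume h: "h \<in> carrier (poset_aut_group geom)"
        have "map_flag h (fl True \<one>) \<in> flags geom"
          by (rule map_flag_aut[OF polyhedron_geom h fl_in_flags]) simp
        then obtain b g where bg: "map_flag h (fl True \<one>) = fl b g" "g \<in> carrier G"
          unfolding flags_geom by blast
        then have "b" using not_reversing[OF h] by (cases b) auto
        then show "h \<in> act ` carrier G" using bg aut_eq_act[OF h] by auto
      qed (use act_aut in auto)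
    qed
    ultimately show "act \<in> iso G (poset_aut_group geom)" by (simp add: iso_def)
  qed
  ultimately show ?thesis
    unfolding is_aut_group_of_tight_chiral_polyhedron_def tight_of_type_def
    using has_type_geom card_flags by blast
qed

end

section \<open>Normal forms in the presented groups\<close>

lemma (in group) commute_mult:
  assumes "e \<in> carrier G" "a \<in> carrier G" "b \<in> carrier G"
    and "e \<otimes> a = a \<otimes> e" "e \<otimes> b = b \<otimes> e"
  shows "e \<otimes> (a \<otimes> b) = a \<otimes> b \<otimes> e"
  using assms by (metis m_assoc)

lemma (in group) commute_inv:
  assumes "e \<in> carrier G" "a \<in> carrier G" and eq: "e \<otimes> a = a \<otimes> e"
  shows "e \<otimes> inv a = inv a \<otimes> e"
proof -
  have "inv a \<otimes> (e \<otimes> a) \<otimes> inv a = inv a \<otimes> (a \<otimes> e) \<otimes> inv a" by (simp only: eq)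
  then show ?thesis using assms(1,2) by (simp add: m_assoc)
qed

lemma (in group) commute_int_pow:
  assumes "e \<in> carrier G" "a \<in> carrier G" and "e \<otimes> a = a \<otimes> e"
  shows "e \<otimes> a [^] (n::int) = a [^] n \<otimes> e"
proof (cases n)
  case (nonneg k)
  then show ?thesis using assms group_commutes_pow[of a e k] by (simp add: int_pow_int)
next
  case (neg k)
  have "e \<otimes> a [^] Suc k = a [^] Suc k \<otimes> e" using assms group_commutes_pow[of a e "Suc k"] by simp
  then show ?thesis using assms commute_inv[of e "a [^] Suc k"] neg
    by (simp only: int_pow_neg_int nat_pow_closed)
qed

lemma (in group) conj_nat_pow:
  assumes "x \<in> carrier G" "y \<in> carrier G"
  shows "(x \<otimes> y \<otimes> inv x) [^] (n::nat) = x \<otimes> y [^] n \<otimes> inv x"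
  by (induction n) (use assms in \<open>simp_all add: m_assoc\<close>)

lemma (in group) class2_commute_pow:
  assumes [simp]: "u \<in> carrier G" "v \<in> carrier G" "e \<in> carrier G"
    and vu: "v \<otimes> u = e \<otimes> (u \<otimes> v)" and ev: "e \<otimes> v = v \<otimes> e"
  shows "v [^] (n::nat) \<otimes> u = e [^] n \<otimes> (u \<otimes> v [^] n)"
proof (induction n)
  case (Suc n)
  have comm: "e [^] n \<otimes> v = v \<otimes> e [^] n" using ev by (intro group_commutes_pow) auto
  have "v [^] Suc n \<otimes> u = v \<otimes> (v [^] n \<otimes> u)" by (simp only: nat_pow_Suc2 m_assoc nat_pow_closed assms)
  also have "\<dots> = (v \<otimes> e [^] n) \<otimes> (u \<otimes> v [^] n)" by (simp add: Suc m_assoc)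
  also have "\<dots> = e [^] n \<otimes> (v \<otimes> u) \<otimes> v [^] n" by (simp add: comm[symmetric] m_assoc)
  also have "\<dots> = e [^] n \<otimes> e \<otimes> (u \<otimes> (v \<otimes> v [^] n))" by (simp add: vu m_assoc)
  also have "v \<otimes> v [^] n = v [^] Suc n" by (rule nat_pow_Suc2[symmetric]) simp
  finally show ?case by simp
qed simp

text \<open>Sorting \<open>n\<close> alternating factors moves a \<open>v\<close> past a
  \<open>u\<close> once for each pair of positions, \<open>n * (n - 1) div 2\<close> times in all,
  and each move costs one factor \<open>e\<close>.\<close>

lemma (in group) class2_mult_pow:
  assumes [simp]: "u \<in> carrier G" "v \<in> carrier G" "e \<in> carrier G"
    and vu: "v \<otimes> u = e \<otimes> (u \<otimes> v)" and eu: "e \<otimes> u = u \<otimes> e" and ev: "e \<otimes> v = v \<otimes> e"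
  shows "(u \<otimes> v) [^] (n::nat) = e [^] (n * (n - 1) div 2) \<otimes> (u [^] n \<otimes> v [^] n)"
proof (induction n)
  case (Suc n)
  let ?t = "n * (n - 1) div 2"
  have t: "Suc n * (Suc n - 1) div 2 = ?t + n" by (cases n) simp_all
  have comm: "u [^] n \<otimes> e [^] n = e [^] n \<otimes> u [^] n"
    using eu by (metis assms(1,3) group_commutes_pow nat_pow_closed)
  have "(u \<otimes> v) [^] Suc n = e [^] ?t \<otimes> (u [^] n \<otimes> (v [^] n \<otimes> u) \<otimes> v)"
    by (simp add: Suc m_assoc)
  also have "\<dots> = e [^] ?t \<otimes> ((u [^] n \<otimes> e [^] n) \<otimes> (u \<otimes> v [^] n) \<otimes> v)"
    by (simp only: class2_commute_pow[OF assms(1-3) vu ev] m_assoc assms m_closed nat_pow_closed)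
  also have "\<dots> = (e [^] ?t \<otimes> e [^] n) \<otimes> ((u [^] n \<otimes> u) \<otimes> (v [^] n \<otimes> v))"
    unfolding comm by (simp add: m_assoc)
  also have "\<dots> = e [^] (?t + n) \<otimes> (u [^] Suc n \<otimes> v [^] Suc n)"
    by (simp add: nat_pow_mult)
  finally show ?case unfolding t .
qed simp

text \<open>This lets the normal form absorb a factor \<open>x\<close> on the right. The inverse of
  the commutator \<open>e\<close> of \<open>X\<close> and \<open>y\<close> turns out to be a power
  of \<open>x\<close> times a power of \<open>y\<close>, commuting with each other, so the
  commutators produced by moving \<open>x\<close> to the left are absorbed by both sides.\<close>

lemma (in group) power_times_generator:
  fixes A :: int and m n b :: nat
  assumes [simp]: "x \<in> carrier G" "y \<in> carrier G"
    and xy: "x \<otimes> y \<otimes> (x \<otimes> y) = \<one>"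
    and r1: "inv y \<otimes> x = x [^] (3 + A) \<otimes> y [^] (1 + int n)"
    and r2: "y \<otimes> inv x = x [^] (- 3 + A) \<otimes> y [^] (- 1 + int n)"
    and r3: "x [^] (2 * int m) \<otimes> y = y \<otimes> x [^] (2 * int m)"
    and A: "2 * int m dvd A" and n: "m dvd n" and m: "odd m"
  shows "\<exists>(i::int) (j::int). y [^] b \<otimes> x = x [^] i \<otimes> y [^] j"
proof -
  define X where "X = x [^] (2::int)"
  define c where "c = x [^] A"
  define d where "d = y [^] n"
  have [simp]: "X \<in> carrier G" "c \<in> carrier G" "d \<in> carrier G" by (simp_all add: X_def c_def d_def)
  \<comment> \<open>As \<open>2 * int m\<close> divides \<open>A\<close>, the element
    \<open>c\<close> is a power of \<open>x [^] (2 * int m)\<close>, which commutes with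
    \<open>y\<close> by \<open>r3\<close>.\<close>
  have c_y: "c \<otimes> y = y \<otimes> c" and Xm_y: "x [^] (2 * int m * l) \<otimes> y = y \<otimes> x [^] (2 * int m * l)" for l
  proof -
    show *: "x [^] (2 * int m * l) \<otimes> y = y \<otimes> x [^] (2 * int m * l)" for l
      using commute_int_pow[of y "x [^] (2 * int m)" l] r3 by (simp add: int_pow_pow)
    show "c \<otimes> y = y \<otimes> c" using A *[of "A div (2 * int m)"] by (simp add: c_def)
  qed
  have c_x: "c \<otimes> x = x \<otimes> c" unfolding c_def by (rule commute_int_pow[symmetric]) simp_all
  have xX: "x \<otimes> X = X \<otimes> x" unfolding X_def by (rule commute_int_pow) simp_all
  have X: "X = x \<otimes> x" using int_pow_mult[of x 1 1] by (simp add: X_def)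
  have xy': "x \<otimes> y = inv y \<otimes> inv x" using inv_equality[OF xy] by (simp add: inv_mult_group)
  have yx': "y \<otimes> x = inv x \<otimes> inv y"
  proof -
    have "inv x \<otimes> (x \<otimes> y \<otimes> (x \<otimes> y)) \<otimes> inv y = inv x \<otimes> \<one> \<otimes> inv y" by (simp only: xy)
    then show ?thesis by (simp add: m_assoc)
  qed
  have x_conj: "x \<otimes> y \<otimes> inv x = inv y \<otimes> inv X" by (simp add: xy' X m_assoc inv_mult_group)
  \<comment> \<open>The commutator of \<open>X\<close> and \<open>y\<close>; it will turn out to be central in \<open>\<langle>X, y\<rangle>\<close>.\<close>
  define e where "e = X \<otimes> y \<otimes> inv X \<otimes> inv y"
  define D where "D = x \<otimes> d \<otimes> inv x"
  have [simp]: "e \<in> carrier G" "D \<in> carrier G" by (simp_all add: e_def D_def)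
  \<comment> \<open>Solve \<open>r1\<close> for \<open>d\<close> and conjugate by \<open>x\<close>.
    Since \<open>c\<close> commutes with \<open>X\<close> and \<open>y\<close>, the factor
    \<open>inv c\<close> in the result is cancelled by \<open>c\<close>.\<close>
  have e1: "c \<otimes> D = e"
  proof -
    have "inv y \<otimes> x = c \<otimes> X \<otimes> (x \<otimes> y) \<otimes> d"
    proof -
      have "x [^] (3 + A) = x [^] (A + 2 + 1)" by (simp add: add.commute)
      then have "x [^] (3 + A) = c \<otimes> X \<otimes> x" by (simp only: int_pow_mult c_def X_def assms int_pow_1)
      moreover have "y [^] (1 + int n) = y \<otimes> d" by (simp only: int_pow_mult int_pow_1 d_def int_pow_int assms)
      ultimately show ?thesis using r1 by (simp add: m_assoc)
    qed
    then have "inv y \<otimes> x = c \<otimes> (X \<otimes> (inv y \<otimes> (inv x \<otimes> d)))" by (simp add: xy' m_assoc)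
    then have "x \<otimes> (y \<otimes> (inv X \<otimes> (inv c \<otimes> (inv y \<otimes> x)))) = d" by simp
    then have "D = x \<otimes> (x \<otimes> (y \<otimes> (inv X \<otimes> (inv c \<otimes> (inv y \<otimes> x))))) \<otimes> inv x" by (simp add: D_def)
    also have "\<dots> = X \<otimes> y \<otimes> inv X \<otimes> inv c \<otimes> inv y" by (simp add: X m_assoc)
    finally have D: "D = X \<otimes> y \<otimes> inv X \<otimes> inv c \<otimes> inv y" .
    have "c \<otimes> X = X \<otimes> c" unfolding X using c_x by (intro commute_mult) simp_all
    then have "c \<otimes> (X \<otimes> y \<otimes> inv X) = (X \<otimes> y \<otimes> inv X) \<otimes> c"
      using c_y by (intro commute_mult commute_inv) simp_all
    then have "c \<otimes> D = (X \<otimes> y \<otimes> inv X) \<otimes> (c \<otimes> (inv c \<otimes> inv y))"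
      unfolding D by (metis (no_types, lifting) \<open>X \<in> carrier G\<close> \<open>c \<in> carrier G\<close> assms(2) inv_closed m_assoc m_closed)
    then show ?thesis by (simp add: e_def)
  qed
  \<comment> \<open>Solving \<open>r2\<close> for the same \<open>d\<close> gives a second
    expression for \<open>c \<otimes> D\<close>.\<close>
  have e2: "e = inv y \<otimes> X \<otimes> y \<otimes> inv X"
  proof -
    have "y \<otimes> inv x = c \<otimes> inv X \<otimes> (inv x \<otimes> inv y) \<otimes> d"
    proof -
      have "x [^] (- 3 + A) = x [^] (A + (- 2) + (- 1))" by (simp add: add.commute)
      then have "x [^] (- 3 + A) = c \<otimes> inv X \<otimes> inv x"
        by (simp only: int_pow_mult c_def X_def assms int_pow_1 int_pow_neg)
      moreover have "y [^] (- 1 + int n) = inv y \<otimes> d"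
        by (simp only: int_pow_mult int_pow_1 d_def int_pow_int int_pow_neg assms)
      ultimately show ?thesis using r2 by (simp add: m_assoc)
    qed
    then have "y \<otimes> inv x = c \<otimes> (inv X \<otimes> (y \<otimes> (x \<otimes> d)))" by (simp add: yx'[symmetric] m_assoc)
    then have "inv x \<otimes> (inv y \<otimes> (X \<otimes> (inv c \<otimes> (y \<otimes> inv x)))) = d" by simp
    then have "D = x \<otimes> (inv x \<otimes> (inv y \<otimes> (X \<otimes> (inv c \<otimes> (y \<otimes> inv x))))) \<otimes> inv x" by (simp add: D_def)
    also have "\<dots> = inv y \<otimes> X \<otimes> inv c \<otimes> y \<otimes> inv X" by (simp add: X m_assoc inv_mult_group)
    finally have D: "D = inv y \<otimes> X \<otimes> inv c \<otimes> y \<otimes> inv X" .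
    have "c \<otimes> X = X \<otimes> c" unfolding X using c_x by (intro commute_mult) simp_all
    then have "c \<otimes> (inv y \<otimes> X) = inv y \<otimes> X \<otimes> c"
      using c_y by (intro commute_mult commute_inv) simp_all
    then have "c \<otimes> D = (inv y \<otimes> X) \<otimes> (c \<otimes> (inv c \<otimes> (y \<otimes> inv X)))"
      unfolding D by (metis (no_types, lifting) \<open>X \<in> carrier G\<close> \<open>c \<in> carrier G\<close> assms(2) inv_closed m_assoc m_closed)
    then show ?thesis using e1 by (simp add: m_assoc)
  qed
  \<comment> \<open>Comparing the two expressions for \<open>e\<close> shows that
    \<open>e \<otimes> y\<close> and \<open>y \<otimes> e\<close> are the same conjugate of
    \<open>y\<close>.\<close>
  have e_y: "e \<otimes> y = y \<otimes> e"
  proof -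
    have "e \<otimes> y = X \<otimes> y \<otimes> inv X" unfolding e_def by (simp add: m_assoc)
    moreover have "y \<otimes> e = X \<otimes> y \<otimes> inv X" unfolding e2 by (simp add: m_assoc)
    ultimately show ?thesis by simp
  qed
  have D_pow: "D = (inv y \<otimes> inv X) [^] n"
    unfolding D_def d_def x_conj[symmetric] by (simp add: conj_nat_pow)
  \<comment> \<open>\<open>D\<close> is a power of \<open>?w\<close>, and \<open>c\<close> commutes
    with \<open>?w\<close>, so \<open>e = c \<otimes> D\<close> commutes with \<open>?w\<close>. It
    also commutes with \<open>y\<close>, hence with \<open>y \<otimes> ?w = inv X\<close>.\<close>
  have e_X: "e \<otimes> inv X = inv X \<otimes> e"
  proof -
    let ?w = "inv y \<otimes> inv X"
    have "D \<otimes> ?w = ?w \<otimes> D" unfolding D_pow by (rule group_commutes_pow) simp_all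
    moreover have "c \<otimes> ?w = ?w \<otimes> c"
      unfolding x_conj[symmetric] using c_x c_y by (intro commute_mult commute_inv) simp_all
    ultimately have "?w \<otimes> e = e \<otimes> ?w"
      unfolding e1[symmetric] by (intro commute_mult) simp_all
    then have "e \<otimes> (y \<otimes> ?w) = y \<otimes> ?w \<otimes> e" by (intro commute_mult[OF _ _ _ e_y]) simp_all
    then show ?thesis by simp
  qed
  have ei: "e \<otimes> inv y = inv y \<otimes> e" using e_y by (intro commute_inv) simp_all
  have rel: "inv X \<otimes> inv y = e \<otimes> (inv y \<otimes> inv X)"
  proof -
    have "e \<otimes> (inv y \<otimes> inv X) = inv y \<otimes> inv X \<otimes> e"
      using ei e_X by (intro commute_mult) simp_all
    also have "\<dots> = inv X \<otimes> inv y" unfolding e_def by (simp add: m_assoc)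
    finally show ?thesis by simp
  qed
  have X_pow: "X [^] l = x [^] (2 * int l)" for l :: nat
    by (simp add: X_def int_pow_pow int_pow_int[symmetric])
  \<comment> \<open>Moving \<open>inv X [^] m\<close> past \<open>inv y\<close> costs
    \<open>e [^] m\<close>, but by \<open>r3\<close> these two elements commute.\<close>
  have em: "e [^] m = \<one>"
  proof -
    have "inv X [^] m \<otimes> inv y = e [^] m \<otimes> (inv y \<otimes> inv X [^] m)"
      by (rule class2_commute_pow[OF _ _ _ rel e_X]) simp_all
    moreover have "inv X [^] m = inv (x [^] (2 * int m))" by (simp add: nat_pow_inv X_pow)
    moreover have "inv (x [^] (2 * int m)) \<otimes> inv y = inv y \<otimes> inv (x [^] (2 * int m))"
      using r3 by (simp add: inv_mult_group[symmetric])
    ultimately have "\<one> \<otimes> (inv y \<otimes> inv X [^] m) = e [^] m \<otimes> (inv y \<otimes> inv X [^] m)" by simp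
    then show ?thesis by (subst (asm) right_cancel) simp_all
  qed
  \<comment> \<open>As \<open>m\<close> is odd, halving keeps the factor \<open>m\<close>. The
    commutator term in the expansion of \<open>D\<close> therefore vanishes.\<close>
  have "m dvd n * (n - 1) div 2"
  proof -
    have "even (n * (n - 1))" by (cases "even n") simp_all
    then have "2 * (n * (n - 1) div 2) = n * (n - 1)" by simp
    then have "m dvd 2 * (n * (n - 1) div 2)" using n by simp
    then show ?thesis using m by (simp add: coprime_dvd_mult_right_iff)
  qed
  then have "e [^] (n * (n - 1) div 2) = \<one>"
    by (metis em dvdE nat_pow_pow nat_pow_one \<open>e \<in> carrier G\<close>)
  then have "D = inv y [^] n \<otimes> inv X [^] n"
    unfolding D_pow using class2_mult_pow[OF _ _ _ rel ei e_X, of n] by simp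
  then have e: "e = c \<otimes> (inv y [^] n \<otimes> inv X [^] n)" using e1 by simp
  \<comment> \<open>The exponent comes from
    \<open>inv e = X [^] n \<otimes> inv c \<otimes> d\<close>. It is a multiple of
    \<open>2 * int m\<close>, so \<open>s\<close> commutes with \<open>y\<close>.\<close>
  define s where "s = x [^] (2 * int n - A)"
  have [simp]: "s \<in> carrier G" by (simp add: s_def)
  have s_y: "s \<otimes> y = y \<otimes> s"
  proof -
    obtain n' where "n = m * n'" using n by blast
    moreover obtain A' where "A = 2 * int m * A'" using A by blast
    ultimately have "2 * int n - A = 2 * int m * (int n' - A')" by (simp add: algebra_simps)
    then show ?thesis using Xm_y unfolding s_def by simp
  qed
  have s_d: "s \<otimes> d = d \<otimes> s"
    unfolding d_def using s_y by (intro group_commutes_pow[symmetric]) simp_all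
  have inv_e: "inv e = s \<otimes> d"
  proof -
    have "inv e = X [^] n \<otimes> d \<otimes> inv c"
      unfolding e d_def by (simp add: inv_mult_group nat_pow_inv m_assoc)
    also have "\<dots> = X [^] n \<otimes> inv c \<otimes> d"
    proof -
      have "c \<otimes> d = d \<otimes> c" unfolding d_def using c_y by (intro group_commutes_pow[symmetric]) simp_all
      then have "d \<otimes> inv c = inv c \<otimes> d" by (intro commute_inv) simp_all
      then show ?thesis by (simp add: m_assoc)
    qed
    also have "X [^] n \<otimes> inv c = s" by (simp add: X_pow c_def s_def int_pow_diff)
    finally show ?thesis .
  qed
  have rel': "inv y \<otimes> inv X = inv e \<otimes> (inv X \<otimes> inv y)" by (simp add: rel)
  have ei': "inv e \<otimes> inv y = inv y \<otimes> inv e" "inv e \<otimes> inv X = inv X \<otimes> inv e"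
    using commute_inv[of "inv y" e] commute_inv[of "inv X" e] ei e_X by simp_all
  define t where "t = b * (b - 1) div 2"
  \<comment> \<open>Conjugating \<open>y\<close> by \<open>inv x\<close> gives
    \<open>inv X \<otimes> inv y\<close>, whose powers are expanded by the class-two formula with
    commutator \<open>inv e\<close>.\<close>
  have "y [^] b \<otimes> x = x \<otimes> (inv x \<otimes> y [^] b \<otimes> inv (inv x))" by (simp add: m_assoc)
  also have "\<dots> = x \<otimes> (inv x \<otimes> y \<otimes> inv (inv x)) [^] b" by (subst conj_nat_pow) simp_all
  also have "inv x \<otimes> y \<otimes> inv (inv x) = inv X \<otimes> inv y" by (simp add: yx' X m_assoc inv_mult_group)
  also have "(inv X \<otimes> inv y) [^] b = inv e [^] t \<otimes> (inv X [^] b \<otimes> inv y [^] b)"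
    unfolding t_def using ei' by (intro class2_mult_pow[OF _ _ _ rel']) simp_all
  also have "\<dots> = inv X [^] b \<otimes> inv e [^] t \<otimes> inv y [^] b"
  proof -
    have "inv X [^] b \<otimes> inv e = inv e \<otimes> inv X [^] b" using ei' by (intro group_commutes_pow) simp_all
    then have "inv e [^] t \<otimes> inv X [^] b = inv X [^] b \<otimes> inv e [^] t" by (intro group_commutes_pow) simp_all
    then show ?thesis by (simp add: m_assoc[symmetric])
  qed
  \<comment> \<open>Now the part in \<open>s\<close> joins the power of \<open>x\<close> on its left
    and the part in \<open>d\<close> the power of \<open>y\<close> on its right.\<close>
  also have "inv e [^] t = s [^] t \<otimes> d [^] t"
    unfolding inv_e using s_d by (intro pow_mult_distrib) simp_all
  finally have "y [^] b \<otimes> x = (x \<otimes> inv X [^] b \<otimes> s [^] t) \<otimes> (d [^] t \<otimes> inv y [^] b)"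
    by (simp add: m_assoc)
  also have "x \<otimes> inv X [^] b \<otimes> s [^] t = x [^] (1 + - (2 * int b) + (2 * int n - A) * int t)"
    by (simp only: int_pow_mult int_pow_neg int_pow_1 int_pow_pow[symmetric] s_def[symmetric]
        int_pow_int nat_pow_inv X_pow assms int_pow_closed \<open>X \<in> carrier G\<close>)
  also have "d [^] t \<otimes> inv y [^] b = y [^] (int n * int t + - int b)"
    by (simp only: int_pow_mult int_pow_neg int_pow_pow[symmetric] d_def int_pow_int nat_pow_inv assms)
  finally show ?thesis by blast
qed

section \<open>Invariants of words\<close>

lemma foldr_cong_arg:
  fixes f :: "'g \<Rightarrow> int \<Rightarrow> int"
  assumes "\<And>l a b. [a = b] (mod N) \<Longrightarrow> [f l a = f l b] (mod N)" and "[a = b] (mod N)"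
  shows "[foldr f w a = foldr f w b] (mod N)"
  using assms by (induction w) auto

text \<open>If formally inverse letters cancel and the relations hold, the action of words on
  residues modulo \<open>N\<close> factors through the presented group. The last letter of a word
  acts first.\<close>

lemma pres_eq_foldr_cong:
  fixes f :: "'g \<times> bool \<Rightarrow> int \<Rightarrow> int"
  assumes "pres_eq R u v"
    and cong: "\<And>l a b. [a = b] (mod N) \<Longrightarrow> [f l a = f l b] (mod N)"
    and cancel: "\<And>g e a. [f (g, e) (f (g, \<not> e) a) = a] (mod N)"
    and rel: "\<And>u v a. (u, v) \<in> R \<Longrightarrow> [foldr f u a = foldr f v a] (mod N)"
  shows "[foldr f u a = foldr f v a] (mod N)"
  using assms(1)
proof (induction arbitrary: a rule: pres_eq.induct)
  case (pres_append u u' v v')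
  have "[foldr f u (foldr f v a) = foldr f u (foldr f v' a)] (mod N)"
    by (rule foldr_cong_arg[OF cong pres_append.IH(2)])
  also have "[foldr f u (foldr f v' a) = foldr f u' (foldr f v' a)] (mod N)"
    by (rule pres_append.IH(1))
  finally show ?case by simp
next
  case (pres_trans u v w)
  then show ?case using cong_trans by blast
qed (use cancel rel in \<open>auto intro: cong_sym\<close>)

lemma presented_group_inv:
  "inv\<^bsub>presented_group R\<^esub> (pres_class R w) = pres_class R (gword_inv w)"
proof -
  interpret group "presented_group R" by (rule group_presented_group)
  show ?thesis
  proof (rule inv_equality)
    show "pres_class R (gword_inv w) \<otimes>\<^bsub>presented_group R\<^esub> pres_class R w = \<one>\<^bsub>presented_group R\<^esub>"
      unfolding presented_group_mult by (simp add: presented_group_def pres_class_eq_iff pres_gword_inv)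
  qed (simp_all add: presented_group_def)
qed

lemma presented_group_pow:
  "pres_class R (gword_pow w z) = pres_class R w [^]\<^bsub>presented_group R\<^esub> z"
proof -
  interpret group "presented_group R" by (rule group_presented_group)
  have [simp]: "pres_class R w \<in> carrier (presented_group R)" for w by (simp add: presented_group_def)
  have pow: "pres_class R (concat (replicate n w)) = pres_class R w [^]\<^bsub>presented_group R\<^esub> n" for n w
  proof (induction n)
    case (Suc n)
    have "pres_class R w [^]\<^bsub>presented_group R\<^esub> Suc n =
        pres_class R w \<otimes>\<^bsub>presented_group R\<^esub> pres_class R w [^]\<^bsub>presented_group R\<^esub> n"
      by (rule nat_pow_Suc2) simp
    then show ?case by (simp add: Suc[symmetric] presented_group_mult)
  qed (simp add: presented_group_def)
  show ?thesis
  proof (cases "0 \<le> z")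
    case True
    then show ?thesis using pow[of "nat z" w] int_pow_int[of "presented_group R" "pres_class R w" "nat z"]
      by (simp add: gword_pow_def)
  next
    case False
    then have "pres_class R w [^]\<^bsub>presented_group R\<^esub> z = inv\<^bsub>presented_group R\<^esub> (pres_class R w [^]\<^bsub>presented_group R\<^esub> nat (- z))"
      using int_pow_neg_int[of "pres_class R w" "nat (- z)"] by simp
    then show ?thesis using False pow[of "nat (- z)" "gword_inv w"]
      by (simp add: gword_pow_def presented_group_inv[symmetric] int_pow_inv)
  qed
qed

text \<open>The common family: \<open>n\<close> is k m^(\<beta>-1) as a natural number and
  \<open>A\<close> is the correction to the exponents 3 and -3. The first presentation has \<alpha>
  = \<beta> and \<open>A = (m + 1) n\<close>, the second has \<open>A = 0\<close>.\<close>

definition chiral_rels :: "nat \<Rightarrow> nat \<Rightarrow> nat \<Rightarrow> int \<Rightarrow> nat \<Rightarrow> (gen gword \<times> gen gword) set" where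
  "chiral_rels m \<alpha> \<beta> A n =
     {(gword_pow \<sigma>1 (2 * int m ^ \<alpha>), []),
      (gword_pow \<sigma>2 (int m ^ \<beta>), []),
      (gword_pow (\<sigma>1 @ \<sigma>2) 2, []),
      (gword_pow \<sigma>2 (-1) @ \<sigma>1, gword_pow \<sigma>1 (3 + A) @ gword_pow \<sigma>2 (1 + int n)),
      (\<sigma>2 @ gword_pow \<sigma>1 (-1), gword_pow \<sigma>1 (-3 + A) @ gword_pow \<sigma>2 (-1 + int n)),
      (gword_pow \<sigma>1 (2 * int m) @ \<sigma>2, \<sigma>2 @ gword_pow \<sigma>1 (2 * int m))}"

text \<open>Later \<open>s\<close> is m^\<alpha> - 1, which gives \<sigma>1 \<sigma>2 the weight
  m^\<alpha>, of order two modulo 2 m^\<alpha>.\<close>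

fun weight :: "int \<Rightarrow> gen \<times> bool \<Rightarrow> int" where
  "weight s (Sigma1, e) = (if e then 1 else - 1)"
| "weight s (Sigma2, e) = (if e then s else - s)"

lemma foldr_weight_concat_replicate:
  "foldr (\<lambda>l a. a + weight s l) (concat (replicate i w)) a = a + int i * foldr (\<lambda>l a. a + weight s l) w 0"
proof -
  have shift: "foldr (\<lambda>l a. a + weight s l) w a = a + foldr (\<lambda>l a. a + weight s l) w 0" for w a
    by (induction w) auto
  show ?thesis
  proof (induction i arbitrary: a)
    case (Suc i)
    then show ?case using shift[of w "a + int i * foldr (\<lambda>l a. a + weight s l) w 0"]
      by (simp add: algebra_simps)
  qed simp
qed

lemma foldr_weight_pow:
  "foldr (\<lambda>l a. a + weight s l) (gword_pow [(x, True)] z) a = a + z * weight s (x, True)"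
  using foldr_weight_concat_replicate[of s "nat z" "[(x, True)]" a]
    foldr_weight_concat_replicate[of s "nat (- z)" "[(x, False)]" a]
  by (cases x) (simp_all add: gword_pow_def gword_inv_def)

text \<open>The values at inverse letters are inverse maps only when t^2 vanishes: then 1 - t
  inverts 1 + t, and -1 - t inverts -1 + t.\<close>

fun affine_letter :: "int \<Rightarrow> gen \<times> bool \<Rightarrow> int \<Rightarrow> int" where
  "affine_letter t (Sigma1, e) a = (if e then (- 1 + t) * a else (- 1 - t) * a)"
| "affine_letter t (Sigma2, e) a = (if e then 1 + (1 + t) * a else (1 - t) * (a - 1))"

lemma affine_cong: "[a = b] (mod N) \<Longrightarrow> [affine_letter t l a = affine_letter t l b] (mod N)"
  by (cases "(t, l, a)" rule: affine_letter.cases) (auto intro!: cong_mult cong_add cong_diff)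

lemma affine_cancel:
  assumes "N dvd t * t"
  shows "[affine_letter t (x, e) (affine_letter t (x, \<not> e) a) = a] (mod N)"
proof -
  have "\<exists>u. affine_letter t (x, e) (affine_letter t (x, \<not> e) a) - a = t * t * u"
  proof (cases x)
    case Sigma1
    then show ?thesis by (intro exI[of _ "- a"]) (auto simp: algebra_simps)
  next
    case Sigma2
    then show ?thesis by (intro exI[of _ "if e then - (a - 1) else - a"]) (auto simp: algebra_simps)
  qed
  then show ?thesis using assms by (auto simp: cong_iff_dvd_diff)
qed

text \<open>This is the expansion of (-1 + t)^z cut off after the linear term; it covers negative z
  as well.\<close>

lemma affine_pow1:
  assumes "N dvd t * t"
  shows "[foldr (affine_letter t) (gword_pow \<sigma>1 z) a = (if even z then 1 else - 1) * (1 - z * t) * a] (mod N)"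
proof -
  have pow: "[foldr (affine_letter t) (concat (replicate i [(Sigma1, e)])) a =
      (- 1) ^ i * (1 - (if e then 1 else - 1) * int i * t) * a] (mod N)" for i e
  proof (induction i)
    case (Suc i)
    define r where "r = (if e then 1 else - 1 :: int)"
    have step: "affine_letter t (Sigma1, e) b = (- 1 + r * t) * b" for b by (simp add: r_def)
    have "[foldr (affine_letter t) (concat (replicate (Suc i) [(Sigma1, e)])) a =
        (- 1 + r * t) * ((- 1) ^ i * (1 - r * int i * t) * a)] (mod N)"
      using Suc by (simp only: replicate_Suc concat.simps foldr_append foldr.simps comp_def id_def step r_def)
        (intro cong_mult cong_refl, simp)
    also have "[(- 1 + r * t) * ((- 1) ^ i * (1 - r * int i * t) * a) =
        (- 1) ^ Suc i * (1 - r * int (Suc i) * t) * a] (mod N)"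
    proof -
      have "(- 1 + r * t) * ((- 1) ^ i * (1 - r * int i * t) * a) -
          (- 1) ^ Suc i * (1 - r * int (Suc i) * t) * a = t * t * (- r * r * int i * (- 1) ^ i * a)"
        by (simp add: algebra_simps)
      then show ?thesis using assms by (simp add: cong_iff_dvd_diff del: power_Suc)
    qed
    finally show ?case by (simp only: r_def)
  qed simp
  show ?thesis
  proof (cases "0 \<le> z")
    case True
    then show ?thesis using pow[of "nat z" True]
      by (cases "even z") (simp_all add: gword_pow_def even_nat_iff)
  next
    case False
    then show ?thesis using pow[of "nat (- z)" False]
      by (cases "even z") (simp_all add: gword_pow_def gword_inv_def even_nat_iff)
  qed
qed

text \<open>The slope is (1 + t)^i = 1 + i t, and the constant term is the sum of the slopes (1 +
  t)^j over j < i, both without terms in t^2.\<close>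

lemma affine_pow2:
  assumes "N dvd t * t"
  shows "[foldr (affine_letter t) (gword_pow \<sigma>2 (int i)) a =
    int i + t * (int i * (int i - 1) div 2) + (1 + int i * t) * a] (mod N)"
proof (induction i)
  case (Suc i)
  have tri: "int (Suc i) * (int (Suc i) - 1) div 2 = int i * (int i - 1) div 2 + int i"
  proof -
    have "int (Suc i) * (int (Suc i) - 1) = int i * (int i - 1) + int i * 2" by (simp add: algebra_simps)
    then show ?thesis by simp
  qed
  define T where "T = int i * (int i - 1) div 2"
  have "[foldr (affine_letter t) (gword_pow \<sigma>2 (int (Suc i))) a =
      1 + (1 + t) * (int i + t * T + (1 + int i * t) * a)] (mod N)"
    using Suc by (simp add: gword_pow_def T_def nat_add_distrib) (intro cong_mult cong_add cong_refl, simp)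
  also have "[1 + (1 + t) * (int i + t * T + (1 + int i * t) * a) =
      int (Suc i) + t * (T + int i) + (1 + int (Suc i) * t) * a] (mod N)"
  proof -
    have "1 + (1 + t) * (int i + t * T + (1 + int i * t) * a) -
        (int (Suc i) + t * (T + int i) + (1 + int (Suc i) * t) * a) = t * t * (T + int i * a)"
      by (simp add: algebra_simps)
    then show ?thesis using assms by (simp add: cong_iff_dvd_diff)
  qed
  finally show ?case unfolding tri T_def .
qed (simp add: gword_pow_def)

section \<open>The two families\<close>

text \<open>\<open>m_dvd_A\<close> makes \<sigma>1^A a power of \<sigma>1^(2m), which commutes with
  \<sigma>2. \<open>A_n\<close> says that the fourth and fifth relations are balanced in weight
  modulo 2 m^\<alpha>.\<close>

locale chiral_parameters =
  fixes m \<alpha> \<beta> n k :: nat and A :: int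
  assumes prime_m: "prime m" and odd_m: "odd m"
    and \<alpha>: "1 \<le> \<alpha>" "\<alpha> \<le> \<beta>" and \<beta>: "2 \<le> \<beta>"
    and n_eq: "n = k * m ^ (\<beta> - 1)" and k: "\<not> m dvd k"
    and A_nonneg: "0 \<le> A" and m_dvd_A: "2 * int m dvd A"
    and A_n: "2 * int m ^ \<alpha> dvd A + int n * (int m ^ \<alpha> - 1)"
begin

abbreviation "R \<equiv> chiral_rels m \<alpha> \<beta> A n"
abbreviation "Q \<equiv> presented_group R"
abbreviation "N \<equiv> int m ^ \<beta>"

text \<open>Half of \<open>n\<close> modulo \<open>m^\<beta>\<close>, since \<open>m n\<close> vanishes there.\<close>

definition t :: int where "t = int ((m + 1) div 2 * n)"

section \<open>Arithmetic modulo m^\<beta>\<close>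

lemma m_ge_3: "3 \<le> m"
  using prime_m odd_m prime_ge_2_nat[of m] by (cases "m = 2") auto

lemma m_dvd_n: "m dvd n"
  using \<beta> by (simp add: n_eq)

lemma m_dvd_t: "int m dvd t"
  using m_dvd_n by (auto simp: t_def simp del: of_nat_mult)

lemma N_dvd_mn: "N dvd int m * int n"
proof -
  have "int m * int n = int k * int m ^ Suc (\<beta> - 1)" by (simp add: n_eq)
  then show ?thesis using \<beta> by simp
qed

lemma N_dvd_mt: "N dvd int m * t"
  using dvd_mult[OF N_dvd_mn, of "int ((m + 1) div 2)"] by (simp add: t_def mult_ac)

lemma N_dvd_n_2t: "N dvd int n - 2 * t"
proof -
  have "2 * ((m + 1) div 2) = m + 1" using odd_m by simp
  moreover have "2 * t = int (2 * ((m + 1) div 2) * n)" by (simp add: t_def)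
  ultimately have "2 * t = int ((m + 1) * n)" by (simp only:)
  then have "int n - 2 * t = - (int m * int n)" by (simp add: algebra_simps)
  then show ?thesis using N_dvd_mn by simp
qed

lemma N_dvd_t_mult: "int m dvd u \<Longrightarrow> N dvd t * u"
  by (metis N_dvd_mt dvd_trans mult.commute mult_dvd_mono dvd_refl)

text \<open>Since \<beta> is at least 2, \<open>m\<close> divides \<open>n\<close> and hence
  \<open>t\<close>, while \<open>m\<close> times \<open>t\<close> vanishes modulo
  \<open>N\<close>.\<close>

lemma N_dvd_tt: "N dvd t * t"
  by (rule N_dvd_t_mult[OF m_dvd_t])

lemma m_dvd_half: "int m dvd u \<Longrightarrow> even u \<Longrightarrow> int m dvd u div 2"
proof -
  assume u: "int m dvd u" "even u"
  then have "int m dvd 2 * (u div 2)" by simp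
  then show ?thesis using odd_m by (simp add: coprime_dvd_mult_right_iff)
qed

section \<open>The defining relations in the affine action and in the weights\<close>

lemma affine_pow1_trivial:
  assumes "even z" "int m dvd z"
  shows "[foldr (affine_letter t) (gword_pow \<sigma>1 z) a = a] (mod N)"
proof -
  have "[foldr (affine_letter t) (gword_pow \<sigma>1 z) a = (1 - z * t) * a] (mod N)"
    using affine_pow1[OF N_dvd_tt, of z a] assms by simp
  also have "[(1 - z * t) * a = a] (mod N)"
  proof -
    have "(1 - z * t) * a - a = t * z * (- a)" by (simp add: algebra_simps)
    then show ?thesis using N_dvd_t_mult[OF assms(2)] by (simp add: cong_iff_dvd_diff del: mult_minus_right)
  qed
  finally show ?thesis .
qed

lemma affine_pow1_odd:
  assumes "odd z"
  shows "[foldr (affine_letter t) (gword_pow \<sigma>1 (z + A)) a = - (1 - z * t) * a] (mod N)"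
proof -
  have "even A" "int m dvd A" using m_dvd_A by (auto elim: dvd_mult_left dvd_mult_right)
  then have "[foldr (affine_letter t) (gword_pow \<sigma>1 (z + A)) a = - (1 - (z + A) * t) * a] (mod N)"
    using affine_pow1[OF N_dvd_tt, of "z + A" a] assms by simp
  also have "[- (1 - (z + A) * t) * a = - (1 - z * t) * a] (mod N)"
  proof -
    have "- (1 - (z + A) * t) * a - - (1 - z * t) * a = t * A * a" by (simp add: algebra_simps)
    then show ?thesis using N_dvd_t_mult[OF \<open>int m dvd A\<close>] by (simp add: cong_iff_dvd_diff)
  qed
  finally show ?thesis .
qed

text \<open>After removing multiples of \<open>t * int m\<close>, the two sides differ by a
  combination of \<open>t * t\<close> and \<open>int n - 2 * t\<close>. This is why \<open>t\<close>
  has to be half of \<open>n\<close> modulo \<open>N\<close>.\<close>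

lemma affine_relation_1:
  "[foldr (affine_letter t) (gword_pow \<sigma>2 (- 1) @ \<sigma>1) a =
    foldr (affine_letter t) (gword_pow \<sigma>1 (3 + A) @ gword_pow \<sigma>2 (1 + int n)) a] (mod N)"
proof -
  let ?T = "int (Suc n) * (int (Suc n) - 1) div 2"
  have T: "int m dvd ?T" using m_dvd_n by (intro m_dvd_half) auto
  have "[foldr (affine_letter t) (gword_pow \<sigma>2 (1 + int n)) a =
      int (Suc n) + t * ?T + (1 + int (Suc n) * t) * a] (mod N)"
    using affine_pow2[OF N_dvd_tt, of "Suc n" a] by simp
  also have "[int (Suc n) + t * ?T + (1 + int (Suc n) * t) * a = 1 + int n + (1 + t) * a] (mod N)"
  proof -
    have "int (Suc n) + t * ?T + (1 + int (Suc n) * t) * a - (1 + int n + (1 + t) * a) =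
        t * ?T + t * int n * a" by (simp add: algebra_simps)
    then show ?thesis using N_dvd_t_mult[OF T] N_dvd_t_mult[of "int n"] m_dvd_n
      by (simp add: cong_iff_dvd_diff)
  qed
  finally have y: "[foldr (affine_letter t) (gword_pow \<sigma>2 (1 + int n)) a = 1 + int n + (1 + t) * a] (mod N)" .
  have "[foldr (affine_letter t) (gword_pow \<sigma>1 (3 + A) @ gword_pow \<sigma>2 (1 + int n)) a =
      - (1 - 3 * t) * (foldr (affine_letter t) (gword_pow \<sigma>2 (1 + int n)) a)] (mod N)"
    using affine_pow1_odd[of 3] by simp
  also have "[- (1 - 3 * t) * (foldr (affine_letter t) (gword_pow \<sigma>2 (1 + int n)) a) =
      - (1 - 3 * t) * (1 + int n + (1 + t) * a)] (mod N)"
    by (intro cong_mult cong_refl y)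
  also have "[- (1 - 3 * t) * (1 + int n + (1 + t) * a) = (1 - t) * ((- 1 + t) * a - 1)] (mod N)"
  proof -
    have "- (1 - 3 * t) * (1 + int n + (1 + t) * a) - (1 - t) * ((- 1 + t) * a - 1) =
        t * t * (6 + 4 * a) + (int n - 2 * t) * (3 * t - 1)" by (simp add: algebra_simps)
    then show ?thesis using N_dvd_tt N_dvd_n_2t by (simp add: cong_iff_dvd_diff)
  qed
  finally have "[foldr (affine_letter t) (gword_pow \<sigma>1 (3 + A) @ gword_pow \<sigma>2 (1 + int n)) a =
      (1 - t) * ((- 1 + t) * a - 1)] (mod N)" .
  moreover have "foldr (affine_letter t) (gword_pow \<sigma>2 (- 1) @ \<sigma>1) a = (1 - t) * ((- 1 + t) * a - 1)"
    by (simp add: gword_pow_def gword_inv_def)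
  ultimately show ?thesis by (simp only: cong_sym_eq)
qed

lemma affine_relation_2:
  "[foldr (affine_letter t) (\<sigma>2 @ gword_pow \<sigma>1 (- 1)) a =
    foldr (affine_letter t) (gword_pow \<sigma>1 (- 3 + A) @ gword_pow \<sigma>2 (- 1 + int n)) a] (mod N)"
proof -
  have "0 < k" using k by (cases k) auto
  \<comment> \<open>The formula for powers of \<sigma>2 covers natural exponents only, so -1 + n
    must not be negative.\<close>
  then have n: "1 \<le> n" using m_ge_3 by (simp add: n_eq)
  let ?T = "(int n - 1) * (int n - 1 - 1) div 2"
  \<comment> \<open>This splits the triangular number into 1 plus a multiple of \<open>m\<close>;
    only the 1 survives multiplication by \<open>t\<close>.\<close>
  have "(int n - 1) * (int n - 1 - 1) = int n * (int n - 3) + 1 * 2" by (simp add: algebra_simps)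
  then have T: "?T = int n * (int n - 3) div 2 + 1" by (simp only: div_mult_self1)
  have T': "int m dvd int n * (int n - 3) div 2" using m_dvd_n by (intro m_dvd_half) auto
  have "[foldr (affine_letter t) (gword_pow \<sigma>2 (- 1 + int n)) a =
      int n - 1 + t * ?T + (1 + (int n - 1) * t) * a] (mod N)"
    using affine_pow2[OF N_dvd_tt, of "n - 1" a] n by (simp add: of_nat_diff)
  also have "[int n - 1 + t * ?T + (1 + (int n - 1) * t) * a = int n - 1 + t + (1 - t) * a] (mod N)"
  proof -
    have "int n - 1 + t * ?T + (1 + (int n - 1) * t) * a - (int n - 1 + t + (1 - t) * a) =
        t * (int n * (int n - 3) div 2) + t * int n * a" unfolding T by (simp add: algebra_simps)
    then show ?thesis using N_dvd_t_mult[OF T'] N_dvd_t_mult[of "int n"] m_dvd_n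
      by (simp add: cong_iff_dvd_diff)
  qed
  finally have y: "[foldr (affine_letter t) (gword_pow \<sigma>2 (- 1 + int n)) a = int n - 1 + t + (1 - t) * a] (mod N)" .
  have "[foldr (affine_letter t) (gword_pow \<sigma>1 (- 3 + A) @ gword_pow \<sigma>2 (- 1 + int n)) a =
      - (1 - (- 3) * t) * (foldr (affine_letter t) (gword_pow \<sigma>2 (- 1 + int n)) a)] (mod N)"
    using affine_pow1_odd[of "- 3" "foldr (affine_letter t) (gword_pow \<sigma>2 (- 1 + int n)) a"]
    by (simp only: foldr_append comp_apply) simp
  also have "[- (1 - (- 3) * t) * (foldr (affine_letter t) (gword_pow \<sigma>2 (- 1 + int n)) a) =
      - (1 - (- 3) * t) * (int n - 1 + t + (1 - t) * a)] (mod N)"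
    by (intro cong_mult cong_refl y)
  also have "[- (1 - (- 3) * t) * (int n - 1 + t + (1 - t) * a) = 1 + (1 + t) * ((- 1 - t) * a)] (mod N)"
  proof -
    have "- (1 - (- 3) * t) * (int n - 1 + t + (1 - t) * a) - (1 + (1 + t) * ((- 1 - t) * a)) =
        t * t * (4 * a - 9) + (int n - 2 * t) * (- 1 - 3 * t)" by (simp add: algebra_simps)
    then show ?thesis using N_dvd_tt N_dvd_n_2t by (simp add: cong_iff_dvd_diff)
  qed
  finally have "[foldr (affine_letter t) (gword_pow \<sigma>1 (- 3 + A) @ gword_pow \<sigma>2 (- 1 + int n)) a =
      1 + (1 + t) * ((- 1 - t) * a)] (mod N)" .
  moreover have "foldr (affine_letter t) (\<sigma>2 @ gword_pow \<sigma>1 (- 1)) a = 1 + (1 + t) * ((- 1 - t) * a)"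
    by (simp add: gword_pow_def gword_inv_def)
  ultimately show ?thesis by (simp only: cong_sym_eq)
qed

lemma affine_relations:
  assumes "(u, v) \<in> R"
  shows "[foldr (affine_letter t) u a = foldr (affine_letter t) v a] (mod N)"
proof -
  have "int m dvd int m ^ \<alpha>" using \<alpha> by simp
  then have rel1: "[foldr (affine_letter t) (gword_pow \<sigma>1 (2 * int m ^ \<alpha>)) a = a] (mod N)"
    by (intro affine_pow1_trivial) simp_all
  have rel2: "[foldr (affine_letter t) (gword_pow \<sigma>2 (int m ^ \<beta>)) a = a] (mod N)"
  proof -
    have "int m dvd int m ^ \<beta>" using \<beta> by simp
    then have T: "int m dvd int m ^ \<beta> * (int m ^ \<beta> - 1) div 2" using odd_m by (intro m_dvd_half) simp_all
    have "[foldr (affine_letter t) (gword_pow \<sigma>2 (int m ^ \<beta>)) a =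
        int m ^ \<beta> + t * (int m ^ \<beta> * (int m ^ \<beta> - 1) div 2) + (1 + int m ^ \<beta> * t) * a] (mod N)"
      using affine_pow2[OF N_dvd_tt, of "m ^ \<beta>" a] by simp
    also have "[int m ^ \<beta> + t * (int m ^ \<beta> * (int m ^ \<beta> - 1) div 2) + (1 + int m ^ \<beta> * t) * a = a] (mod N)"
    proof -
      have eq: "int m ^ \<beta> + t * (int m ^ \<beta> * (int m ^ \<beta> - 1) div 2) + (1 + int m ^ \<beta> * t) * a - a =
          t * (int m ^ \<beta> * (int m ^ \<beta> - 1) div 2) + int m ^ \<beta> * (1 + t * a)" by (simp add: algebra_simps)
      show ?thesis unfolding cong_iff_dvd_diff eq using N_dvd_t_mult[OF T] by simp
    qed
    finally show ?thesis .
  qed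
  have rel3: "[foldr (affine_letter t) (gword_pow (\<sigma>1 @ \<sigma>2) 2) a = a] (mod N)"
  proof -
    have "foldr (affine_letter t) (gword_pow (\<sigma>1 @ \<sigma>2) 2) a - a = t * t * (t - 1 - 2 * a + t * t * a)"
      by (simp add: gword_pow_def numeral_2_eq_2 algebra_simps)
    then show ?thesis using N_dvd_tt by (simp add: cong_iff_dvd_diff)
  qed
  have rel6: "[foldr (affine_letter t) (gword_pow \<sigma>1 (2 * int m) @ \<sigma>2) a =
      foldr (affine_letter t) (\<sigma>2 @ gword_pow \<sigma>1 (2 * int m)) a] (mod N)"
  proof -
    have triv: "[foldr (affine_letter t) (gword_pow \<sigma>1 (2 * int m)) b = b] (mod N)" for b
      by (intro affine_pow1_trivial) simp_all
    have "[foldr (affine_letter t) (gword_pow \<sigma>1 (2 * int m) @ \<sigma>2) a = affine_letter t (Sigma2, True) a] (mod N)"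
      using triv[of "affine_letter t (Sigma2, True) a"] by (simp del: affine_letter.simps)
    moreover have "[foldr (affine_letter t) (\<sigma>2 @ gword_pow \<sigma>1 (2 * int m)) a = affine_letter t (Sigma2, True) a] (mod N)"
      using affine_cong[OF triv[of a], of t "(Sigma2, True)"] by (simp del: affine_letter.simps)
    ultimately show ?thesis using cong_sym cong_trans by blast
  qed
  show ?thesis
    using assms rel1 rel2 rel3 affine_relation_1 affine_relation_2 rel6
    unfolding chiral_rels_def by (elim insertE emptyE) (simp_all only: prod.inject foldr.simps id_apply)
qed

text \<open>The power of \<sigma>2 is harmless because \<alpha> is at most \<beta> and m^\<alpha> -
  1 is even. The fourth and fifth relations change the weight by the quantity in \<open>A_n\<close>,
  up to one multiple of the modulus.\<close>

lemma weight_relations: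
  assumes "(u, v) \<in> R"
  shows "[foldr (\<lambda>l a. a + weight (int m ^ \<alpha> - 1) l) u a =
    foldr (\<lambda>l a. a + weight (int m ^ \<alpha> - 1) l) v a] (mod 2 * int m ^ \<alpha>)"
proof -
  let ?f = "\<lambda>l a. a + weight (int m ^ \<alpha> - 1) l" and ?P = "2 * int m ^ \<alpha>"
  have "?P dvd int m ^ \<beta> * (int m ^ \<alpha> - 1)"
  proof -
    have "int m ^ \<alpha> * 2 dvd int m ^ \<beta> * (int m ^ \<alpha> - 1)"
      using \<alpha> odd_m by (intro mult_dvd_mono le_imp_power_dvd) simp_all
    then show ?thesis by (simp add: mult.commute)
  qed
  then have rel2: "[foldr ?f (gword_pow \<sigma>2 (int m ^ \<beta>)) a = foldr ?f [] a] (mod ?P)"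
    by (simp add: foldr_weight_pow cong_iff_dvd_diff)
  have rel1: "[foldr ?f (gword_pow \<sigma>1 (2 * int m ^ \<alpha>)) a = foldr ?f [] a] (mod ?P)"
    by (simp add: foldr_weight_pow cong_iff_dvd_diff)
  have rel3: "[foldr ?f (gword_pow (\<sigma>1 @ \<sigma>2) 2) a = foldr ?f [] a] (mod ?P)"
    by (simp add: gword_pow_def numeral_2_eq_2 cong_iff_dvd_diff algebra_simps)
  have rel4: "[foldr ?f (gword_pow \<sigma>2 (- 1) @ \<sigma>1) a =
      foldr ?f (gword_pow \<sigma>1 (3 + A) @ gword_pow \<sigma>2 (1 + int n)) a] (mod ?P)"
  proof -
    have eq: "foldr ?f (gword_pow \<sigma>1 (3 + A) @ gword_pow \<sigma>2 (1 + int n)) a -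
        foldr ?f (gword_pow \<sigma>2 (- 1) @ \<sigma>1) a = (A + int n * (int m ^ \<alpha> - 1)) + ?P"
      by (simp add: foldr_weight_pow algebra_simps)
    show ?thesis by (rule cong_sym, unfold cong_iff_dvd_diff eq) (use A_n in simp)
  qed
  have rel5: "[foldr ?f (\<sigma>2 @ gword_pow \<sigma>1 (- 1)) a =
      foldr ?f (gword_pow \<sigma>1 (- 3 + A) @ gword_pow \<sigma>2 (- 1 + int n)) a] (mod ?P)"
  proof -
    have eq: "foldr ?f (gword_pow \<sigma>1 (- 3 + A) @ gword_pow \<sigma>2 (- 1 + int n)) a -
        foldr ?f (\<sigma>2 @ gword_pow \<sigma>1 (- 1)) a = (A + int n * (int m ^ \<alpha> - 1)) - ?P"
      by (simp add: foldr_weight_pow algebra_simps)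
    show ?thesis by (rule cong_sym, unfold cong_iff_dvd_diff eq) (use A_n in simp)
  qed
  have rel6: "foldr ?f (gword_pow \<sigma>1 (2 * int m) @ \<sigma>2) a = foldr ?f (\<sigma>2 @ gword_pow \<sigma>1 (2 * int m)) a"
    by (simp add: foldr_weight_pow)
  show ?thesis
    using assms rel1 rel2 rel3 rel4 rel5 rel6
    unfolding chiral_rels_def by (elim insertE emptyE) (simp_all only: prod.inject cong_refl)
qed

text \<open>It is 2 modulo \<open>m\<close>, and \<open>m\<close> is an odd prime.\<close>

lemma coprime_unit: "coprime N (2 + t * u)"
proof -
  have "coprime (int m) (2 + t * u)"
  proof (rule prime_imp_coprime)
    show "prime (int m)" using prime_m by simp
    show "\<not> int m dvd 2 + t * u"
    proof
      assume "int m dvd 2 + t * u"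
      then have "int m dvd 2" using m_dvd_t by (metis dvd_add_left_iff dvd_mult2)
      then show False using zdvd_imp_le[of "int m" 2] m_ge_3 by simp
    qed
  qed
  then show ?thesis by simp
qed

text \<open>Let the word act on the point 0. The power of \<sigma>1 multiplies by a unit, so the
  power of \<sigma>2 already fixes 0, which forces m^\<beta> to divide \<open>j\<close>. Then the
  second factor has weight 0 and the weight of the first determines \<open>i\<close>.\<close>

lemma normal_form_independent:
  assumes "pres_eq R (gword_pow \<sigma>1 (int i) @ gword_pow \<sigma>2 (int j)) []"
  shows "2 * m ^ \<alpha> dvd i \<and> m ^ \<beta> dvd j"
proof -
  let ?T = "int j * (int j - 1) div 2"
  have "[foldr (affine_letter t) (gword_pow \<sigma>1 (int i) @ gword_pow \<sigma>2 (int j)) 0 = foldr (affine_letter t) [] 0] (mod N)"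
    by (rule pres_eq_foldr_cong[OF assms affine_cong affine_cancel[OF N_dvd_tt] affine_relations])
  then have "[foldr (affine_letter t) (gword_pow \<sigma>1 (int i)) (foldr (affine_letter t) (gword_pow \<sigma>2 (int j)) 0) = 0] (mod N)"
    by simp
  then have *: "[(if even (int i) then 1 else - 1) * (1 - int i * t) * (foldr (affine_letter t) (gword_pow \<sigma>2 (int j)) 0) = 0] (mod N)"
    using affine_pow1[OF N_dvd_tt, of "int i" "foldr (affine_letter t) (gword_pow \<sigma>2 (int j)) 0"] cong_sym cong_trans by blast
  define c where "c = (1 - int i * t) * (foldr (affine_letter t) (gword_pow \<sigma>2 (int j)) 0)"
  have "N dvd c"
    using * unfolding mult.assoc c_def[symmetric] by (simp add: cong_0_iff split: if_splits)
  then have "N dvd (1 - int i * t) * (foldr (affine_letter t) (gword_pow \<sigma>2 (int j)) 0)" by (simp only: c_def)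
  moreover have "coprime N (1 - int i * t)"
  proof -
    have "coprime N (2 + t * (- 2 * int i))" by (rule coprime_unit)
    moreover have "2 + t * (- 2 * int i) = 2 * (1 - int i * t)" by (simp add: algebra_simps)
    ultimately show ?thesis by (metis coprime_mult_right_iff)
  qed
  ultimately have "N dvd foldr (affine_letter t) (gword_pow \<sigma>2 (int j)) 0"
    by (simp add: coprime_dvd_mult_right_iff)
  moreover have "[foldr (affine_letter t) (gword_pow \<sigma>2 (int j)) 0 = int j + t * ?T] (mod N)"
    using affine_pow2[OF N_dvd_tt, of j 0] by simp
  ultimately have "N dvd int j + t * ?T" using cong_dvd_iff by blast
  \<comment> \<open>Doubling clears the half in \<open>?T\<close> and exposes \<open>int j\<close>
    times a unit.\<close>
  then have "N dvd 2 * (int j + t * ?T)" by (rule dvd_mult)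
  also have "2 * (int j + t * ?T) = int j * (2 + t * (int j - 1))"
  proof -
    have "2 * ?T = int j * (int j - 1)" by simp
    then have "2 * (int j + t * ?T) = 2 * int j + t * (int j * (int j - 1))" by (metis distrib_left mult.left_commute)
    then show ?thesis by (simp add: algebra_simps)
  qed
  finally have "N dvd int j" using coprime_unit coprime_dvd_mult_left_iff by blast
  then have j: "m ^ \<beta> dvd j" by (metis of_nat_dvd_iff of_nat_power)
  let ?f = "\<lambda>l a. a + weight (int m ^ \<alpha> - 1) l" and ?P = "2 * int m ^ \<alpha>"
  have "[foldr ?f (gword_pow \<sigma>1 (int i) @ gword_pow \<sigma>2 (int j)) 0 = foldr ?f [] 0] (mod ?P)"
  proof (rule pres_eq_foldr_cong[OF assms])
    show "[?f (g, e) (?f (g, \<not> e) a) = a] (mod ?P)" for g e a by (cases g) auto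
    show "[?f l a = ?f l b] (mod ?P)" if "[a = b] (mod ?P)" for l a b
      by (rule cong_add[OF that cong_refl])
  qed (rule weight_relations)
  then have "?P dvd int i + int j * (int m ^ \<alpha> - 1)"
    by (simp add: foldr_weight_pow cong_0_iff add.commute)
  moreover have "?P dvd int j * (int m ^ \<alpha> - 1)"
  proof -
    have "int m ^ \<alpha> dvd int j" using j \<alpha> by (metis dvd_trans le_imp_power_dvd of_nat_dvd_iff of_nat_power)
    then have "int m ^ \<alpha> * 2 dvd int j * (int m ^ \<alpha> - 1)" using odd_m by (intro mult_dvd_mono) simp_all
    then show ?thesis by (simp add: mult.commute)
  qed
  ultimately have "?P dvd int i" by (simp add: dvd_add_left_iff)
  then have "int (2 * m ^ \<alpha>) dvd int i" by simp
  then show ?thesis using j of_nat_dvd_iff by blast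
qed

section \<open>The presented group meets the hypotheses of the coset construction\<close>

sublocale group Q by (rule group_presented_group)

definition s1 where "s1 = pres_class R \<sigma>1"
definition s2 where "s2 = pres_class R \<sigma>2"

lemma gens_closed [simp]: "s1 \<in> carrier Q" "s2 \<in> carrier Q"
  by (simp_all add: s1_def s2_def presented_group_def)

lemma relations_mem:
  "(gword_pow \<sigma>1 (2 * int m ^ \<alpha>), []) \<in> R"
  "(gword_pow \<sigma>2 (int m ^ \<beta>), []) \<in> R"
  "(gword_pow (\<sigma>1 @ \<sigma>2) 2, []) \<in> R"
  "(gword_pow \<sigma>2 (- 1) @ \<sigma>1, gword_pow \<sigma>1 (3 + A) @ gword_pow \<sigma>2 (1 + int n)) \<in> R"
  "(\<sigma>2 @ gword_pow \<sigma>1 (- 1), gword_pow \<sigma>1 (- 3 + A) @ gword_pow \<sigma>2 (- 1 + int n)) \<in> R"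
  "(gword_pow \<sigma>1 (2 * int m) @ \<sigma>2, \<sigma>2 @ gword_pow \<sigma>1 (2 * int m)) \<in> R"
  unfolding chiral_rels_def by blast+

lemma class_rel: "(u, v) \<in> R \<Longrightarrow> pres_class R u = pres_class R v"
  by (simp add: pres_class_eq_iff pres_rel)

lemma class_append: "pres_class R (u @ v) = pres_class R u \<otimes>\<^bsub>Q\<^esub> pres_class R v"
  by (simp add: presented_group_mult)

lemma group_relations:
  "s1 [^]\<^bsub>Q\<^esub> (2 * m ^ \<alpha>) = \<one>\<^bsub>Q\<^esub>" "s2 [^]\<^bsub>Q\<^esub> (m ^ \<beta>) = \<one>\<^bsub>Q\<^esub>"
  "s1 \<otimes>\<^bsub>Q\<^esub> s2 \<otimes>\<^bsub>Q\<^esub> (s1 \<otimes>\<^bsub>Q\<^esub> s2) = \<one>\<^bsub>Q\<^esub>"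
  "inv\<^bsub>Q\<^esub> s2 \<otimes>\<^bsub>Q\<^esub> s1 = s1 [^]\<^bsub>Q\<^esub> (3 + A) \<otimes>\<^bsub>Q\<^esub> s2 [^]\<^bsub>Q\<^esub> (1 + int n)"
  "s2 \<otimes>\<^bsub>Q\<^esub> inv\<^bsub>Q\<^esub> s1 = s1 [^]\<^bsub>Q\<^esub> (- 3 + A) \<otimes>\<^bsub>Q\<^esub> s2 [^]\<^bsub>Q\<^esub> (- 1 + int n)"
  "s1 [^]\<^bsub>Q\<^esub> (2 * int m) \<otimes>\<^bsub>Q\<^esub> s2 = s2 \<otimes>\<^bsub>Q\<^esub> s1 [^]\<^bsub>Q\<^esub> (2 * int m)"
proof -
  have one: "pres_class R [] = \<one>\<^bsub>Q\<^esub>" by (simp add: presented_group_def)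
  note simps = class_append presented_group_pow one s1_def[symmetric] s2_def[symmetric]
  have neg: "x [^]\<^bsub>Q\<^esub> (- 1 :: int) = inv\<^bsub>Q\<^esub> x" if "x \<in> carrier Q" for x
    using int_pow_neg[OF that, of 1] that by simp
  have "s1 [^]\<^bsub>Q\<^esub> (2 * int m ^ \<alpha>) = \<one>\<^bsub>Q\<^esub>"
    using class_rel[OF relations_mem(1)] unfolding simps .
  then show "s1 [^]\<^bsub>Q\<^esub> (2 * m ^ \<alpha>) = \<one>\<^bsub>Q\<^esub>"
    using int_pow_int[of Q s1 "2 * m ^ \<alpha>"] by simp
  have "s2 [^]\<^bsub>Q\<^esub> (int m ^ \<beta>) = \<one>\<^bsub>Q\<^esub>"
    using class_rel[OF relations_mem(2)] unfolding simps .
  then show "s2 [^]\<^bsub>Q\<^esub> (m ^ \<beta>) = \<one>\<^bsub>Q\<^esub>"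
    using int_pow_int[of Q s2 "m ^ \<beta>"] by simp
  have "(s1 \<otimes>\<^bsub>Q\<^esub> s2) [^]\<^bsub>Q\<^esub> (2 :: int) = \<one>\<^bsub>Q\<^esub>"
    using class_rel[OF relations_mem(3)] unfolding simps .
  then show "s1 \<otimes>\<^bsub>Q\<^esub> s2 \<otimes>\<^bsub>Q\<^esub> (s1 \<otimes>\<^bsub>Q\<^esub> s2) = \<one>\<^bsub>Q\<^esub>"
    using int_pow_mult[of "s1 \<otimes>\<^bsub>Q\<^esub> s2" 1 1] by simp
  show "inv\<^bsub>Q\<^esub> s2 \<otimes>\<^bsub>Q\<^esub> s1 = s1 [^]\<^bsub>Q\<^esub> (3 + A) \<otimes>\<^bsub>Q\<^esub> s2 [^]\<^bsub>Q\<^esub> (1 + int n)"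
    using class_rel[OF relations_mem(4)] unfolding simps by (simp add: neg)
  show "s2 \<otimes>\<^bsub>Q\<^esub> inv\<^bsub>Q\<^esub> s1 = s1 [^]\<^bsub>Q\<^esub> (- 3 + A) \<otimes>\<^bsub>Q\<^esub> s2 [^]\<^bsub>Q\<^esub> (- 1 + int n)"
    using class_rel[OF relations_mem(5)] unfolding simps by (simp add: neg)
  show "s1 [^]\<^bsub>Q\<^esub> (2 * int m) \<otimes>\<^bsub>Q\<^esub> s2 = s2 \<otimes>\<^bsub>Q\<^esub> s1 [^]\<^bsub>Q\<^esub> (2 * int m)"
    using class_rel[OF relations_mem(6)] unfolding simps .
qed

lemma int_pow_eq_nat_pow:
  fixes l :: nat
  assumes "x \<in> carrier Q" "x [^]\<^bsub>Q\<^esub> l = \<one>\<^bsub>Q\<^esub>" "0 < l"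
  shows "\<exists>i::nat. x [^]\<^bsub>Q\<^esub> (z::int) = x [^]\<^bsub>Q\<^esub> i"
proof
  have "x [^]\<^bsub>Q\<^esub> z = x [^]\<^bsub>Q\<^esub> (int l * (z div int l) + z mod int l)" by simp
  also have "\<dots> = (x [^]\<^bsub>Q\<^esub> int l) [^]\<^bsub>Q\<^esub> (z div int l) \<otimes>\<^bsub>Q\<^esub> x [^]\<^bsub>Q\<^esub> (z mod int l)"
    using assms(1) by (simp only: int_pow_mult int_pow_pow)
  also have "x [^]\<^bsub>Q\<^esub> int l = \<one>\<^bsub>Q\<^esub>" using assms(2) by (simp only: int_pow_int)
  also have "x [^]\<^bsub>Q\<^esub> (z mod int l) = x [^]\<^bsub>Q\<^esub> nat (z mod int l)"
    using int_pow_int[of Q x "nat (z mod int l)"] assms(3) by simp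
  finally show "x [^]\<^bsub>Q\<^esub> z = x [^]\<^bsub>Q\<^esub> nat (z mod int l)" using assms(1) by simp
qed

text \<open>The set \<open>S\<close> of normal forms contains the identity and is closed under right
  multiplication by \<open>s1\<close>, by \<open>power_times_generator\<close>, and by
  \<open>s2\<close>. Inverses of generators are natural powers, so \<open>S\<close> contains the
  class of every word.\<close>

lemma normal_form:
  assumes "g \<in> carrier Q"
  shows "\<exists>(a::nat) (b::nat). g = s1 [^]\<^bsub>Q\<^esub> a \<otimes>\<^bsub>Q\<^esub> s2 [^]\<^bsub>Q\<^esub> b"
proof -
  define S where "S = {s1 [^]\<^bsub>Q\<^esub> a \<otimes>\<^bsub>Q\<^esub> s2 [^]\<^bsub>Q\<^esub> b | (a::nat) (b::nat). True}"
  have m0: "0 < m" using m_ge_3 by simp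
  have S_s1: "g \<otimes>\<^bsub>Q\<^esub> s1 \<in> S" if gS: "g \<in> S" for g
  proof -
    obtain a b :: nat where g: "g = s1 [^]\<^bsub>Q\<^esub> a \<otimes>\<^bsub>Q\<^esub> s2 [^]\<^bsub>Q\<^esub> b" using gS unfolding S_def by blast
    obtain i j :: int where "s2 [^]\<^bsub>Q\<^esub> b \<otimes>\<^bsub>Q\<^esub> s1 = s1 [^]\<^bsub>Q\<^esub> i \<otimes>\<^bsub>Q\<^esub> s2 [^]\<^bsub>Q\<^esub> j"
      using power_times_generator[OF gens_closed group_relations(3-6) m_dvd_A m_dvd_n odd_m] by blast
    moreover obtain i' :: nat where "s1 [^]\<^bsub>Q\<^esub> i = s1 [^]\<^bsub>Q\<^esub> i'"
      using int_pow_eq_nat_pow[OF gens_closed(1) group_relations(1)] m0 by auto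
    moreover obtain j' :: nat where "s2 [^]\<^bsub>Q\<^esub> j = s2 [^]\<^bsub>Q\<^esub> j'"
      using int_pow_eq_nat_pow[OF gens_closed(2) group_relations(2)] m0 by auto
    ultimately have "g \<otimes>\<^bsub>Q\<^esub> s1 = s1 [^]\<^bsub>Q\<^esub> a \<otimes>\<^bsub>Q\<^esub> (s1 [^]\<^bsub>Q\<^esub> i' \<otimes>\<^bsub>Q\<^esub> s2 [^]\<^bsub>Q\<^esub> j')"
      unfolding g by (simp add: m_assoc)
    also have "\<dots> = s1 [^]\<^bsub>Q\<^esub> (a + i') \<otimes>\<^bsub>Q\<^esub> s2 [^]\<^bsub>Q\<^esub> j'"
      by (simp add: m_assoc[symmetric] nat_pow_mult)
    finally show ?thesis unfolding S_def by blast
  qed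
  have S_s2: "g \<otimes>\<^bsub>Q\<^esub> s2 \<in> S" if gS: "g \<in> S" for g
  proof -
    obtain a b :: nat where g: "g = s1 [^]\<^bsub>Q\<^esub> a \<otimes>\<^bsub>Q\<^esub> s2 [^]\<^bsub>Q\<^esub> b" using gS unfolding S_def by blast
    then have "g \<otimes>\<^bsub>Q\<^esub> s2 = s1 [^]\<^bsub>Q\<^esub> a \<otimes>\<^bsub>Q\<^esub> s2 [^]\<^bsub>Q\<^esub> Suc b" by (simp add: m_assoc)
    then show ?thesis unfolding S_def by blast
  qed
  have S_carrier: "g \<in> carrier Q" if "g \<in> S" for g using that by (auto simp: S_def)
  have S_pow: "g \<otimes>\<^bsub>Q\<^esub> x [^]\<^bsub>Q\<^esub> i \<in> S" if "g \<in> S" and x: "x = s1 \<or> x = s2" for g x and i :: nat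
  proof (induction i)
    case (Suc i)
    then show ?case using S_s1 S_s2 S_carrier[OF that(1)] x by (auto simp: m_assoc[symmetric])
  qed (use that S_carrier in auto)
  have inv_pow: "\<exists>i::nat. inv\<^bsub>Q\<^esub> x = x [^]\<^bsub>Q\<^esub> i" if "x = s1 \<or> x = s2" for x
  proof -
    have "x \<in> carrier Q" using that by auto
    then have "inv\<^bsub>Q\<^esub> x = x [^]\<^bsub>Q\<^esub> (- 1 :: int)" using int_pow_neg[of x 1] by simp
    then show ?thesis
      using that m0 int_pow_eq_nat_pow[OF gens_closed(1) group_relations(1)]
        int_pow_eq_nat_pow[OF gens_closed(2) group_relations(2)] by auto
  qed
  have S_letter: "g \<otimes>\<^bsub>Q\<^esub> pres_class R [l] \<in> S" if "g \<in> S" for g l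
  proof -
    obtain x e where l: "l = (x, e)" by (cases l)
    obtain w where w: "w = \<sigma>1 \<or> w = \<sigma>2" "[(x, True)] = w" by (cases x) auto
    let ?c = "pres_class R w"
    have c: "?c = s1 \<or> ?c = s2" using w by (auto simp: s1_def s2_def)
    have "gword_inv w = [(x, False)]" using w(2) by (auto simp: gword_inv_def)
    then have "pres_class R [l] = (if e then ?c else inv\<^bsub>Q\<^esub> ?c)"
      using w l by (simp add: presented_group_inv)
    moreover obtain i :: nat where "inv\<^bsub>Q\<^esub> ?c = ?c [^]\<^bsub>Q\<^esub> i" using inv_pow[OF c] by blast
    moreover have "g \<otimes>\<^bsub>Q\<^esub> ?c \<in> S" using c S_s1 S_s2 that by metis
    ultimately show ?thesis using S_pow[OF that c, of i] by simp
  qed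
  obtain w where w: "g = pres_class R w" using assms by (auto simp: presented_group_def)
  have "pres_class R w \<in> S"
  proof (induction w rule: rev_induct)
    case Nil
    have "pres_class R [] = \<one>\<^bsub>Q\<^esub>" by (simp add: presented_group_def)
    then have "pres_class R [] = s1 [^]\<^bsub>Q\<^esub> (0::nat) \<otimes>\<^bsub>Q\<^esub> s2 [^]\<^bsub>Q\<^esub> (0::nat)" by simp
    then show ?case unfolding S_def by blast
  next
    case (snoc l w)
    then show ?case using S_letter by (simp add: class_append)
  qed
  then show ?thesis using w unfolding S_def by blast
qed

lemma q_not_dvd: "\<not> m ^ \<beta> dvd 2 * n"
proof
  assume "m ^ \<beta> dvd 2 * n"
  moreover have "m ^ \<beta> = m * m ^ (\<beta> - 1)" using \<beta> by (cases \<beta>) simp_all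
  ultimately have "m * m ^ (\<beta> - 1) dvd (2 * k) * m ^ (\<beta> - 1)" by (simp add: n_eq mult.assoc)
  then have "m dvd 2 * k" using m_ge_3 dvd_times_right_cancel_iff[of "m ^ (\<beta> - 1)" m "2 * k"] by simp
  then show False using k odd_m by (simp add: coprime_dvd_mult_right_iff)
qed

lemma independent:
  fixes a b :: nat
  assumes "s1 [^]\<^bsub>Q\<^esub> a \<otimes>\<^bsub>Q\<^esub> s2 [^]\<^bsub>Q\<^esub> b = \<one>\<^bsub>Q\<^esub>"
  shows "2 * m ^ \<alpha> dvd a \<and> m ^ \<beta> dvd b"
proof (rule normal_form_independent)
  have "pres_class R (gword_pow \<sigma>1 (int a) @ gword_pow \<sigma>2 (int b)) = pres_class R []"
    using assms unfolding class_append presented_group_pow s1_def[symmetric] s2_def[symmetric]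
    by (simp add: int_pow_int) (simp add: presented_group_def)
  then show "pres_eq R (gword_pow \<sigma>1 (int a) @ gword_pow \<sigma>2 (int b)) []"
    by (simp add: pres_class_eq_iff)
qed

lemma no_inverting_map:
  assumes \<theta>: "\<And>g. g \<in> carrier Q \<Longrightarrow> \<theta> g \<in> carrier Q"
    and \<theta>1: "\<And>g. g \<in> carrier Q \<Longrightarrow> \<theta> (s1 \<otimes>\<^bsub>Q\<^esub> g) = inv\<^bsub>Q\<^esub> s1 \<otimes>\<^bsub>Q\<^esub> \<theta> g"
    and \<theta>2: "\<And>g. g \<in> carrier Q \<Longrightarrow> \<theta> (s2 \<otimes>\<^bsub>Q\<^esub> g) = inv\<^bsub>Q\<^esub> s2 \<otimes>\<^bsub>Q\<^esub> \<theta> g"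
  shows False
proof -
  have pow: "\<theta> (x [^]\<^bsub>Q\<^esub> i \<otimes>\<^bsub>Q\<^esub> g) = inv\<^bsub>Q\<^esub> (x [^]\<^bsub>Q\<^esub> i) \<otimes>\<^bsub>Q\<^esub> \<theta> g"
    if "x = s1 \<or> x = s2" and g: "g \<in> carrier Q" for x g and i :: nat
  proof (induction i)
    case (Suc i)
    have x: "x \<in> carrier Q" using that by auto
    have "x [^]\<^bsub>Q\<^esub> Suc i = x \<otimes>\<^bsub>Q\<^esub> x [^]\<^bsub>Q\<^esub> i" by (rule nat_pow_Suc2[OF x])
    then have "\<theta> (x [^]\<^bsub>Q\<^esub> Suc i \<otimes>\<^bsub>Q\<^esub> g) = inv\<^bsub>Q\<^esub> x \<otimes>\<^bsub>Q\<^esub> \<theta> (x [^]\<^bsub>Q\<^esub> i \<otimes>\<^bsub>Q\<^esub> g)"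
      using that x \<theta>1 \<theta>2 by (auto simp: m_assoc)
    then show ?case using x g \<theta> by (simp add: Suc inv_mult_group m_assoc)
  qed (use g \<theta> in simp)
  \<comment> \<open>Natural exponents are needed because \<theta> is known only on left
    multiplication by the generators themselves; \<open>A_nonneg\<close> makes 3 + A
    natural.\<close>
  define a b where "a = nat (3 + A)" and "b = Suc n"
  have pows: "s1 [^]\<^bsub>Q\<^esub> (3 + A) = s1 [^]\<^bsub>Q\<^esub> a" "s2 [^]\<^bsub>Q\<^esub> (1 + int n) = s2 [^]\<^bsub>Q\<^esub> b"
    using int_pow_int[of Q s1 a] int_pow_int[of Q s2 b] A_nonneg by (simp_all add: a_def b_def)
  let ?u = "\<theta> \<one>\<^bsub>Q\<^esub>"
  have u: "?u \<in> carrier Q" by (rule \<theta>) simp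
  have rel: "s2 \<otimes>\<^bsub>Q\<^esub> (s1 [^]\<^bsub>Q\<^esub> a \<otimes>\<^bsub>Q\<^esub> (s2 [^]\<^bsub>Q\<^esub> b \<otimes>\<^bsub>Q\<^esub> \<one>\<^bsub>Q\<^esub>)) = s1 \<otimes>\<^bsub>Q\<^esub> \<one>\<^bsub>Q\<^esub>"
    using group_relations(4) unfolding pows
    by (metis gens_closed inv_closed inv_inv inv_solve_left m_closed nat_pow_closed r_one)
  have "inv\<^bsub>Q\<^esub> s2 \<otimes>\<^bsub>Q\<^esub> (inv\<^bsub>Q\<^esub> (s1 [^]\<^bsub>Q\<^esub> a) \<otimes>\<^bsub>Q\<^esub> (inv\<^bsub>Q\<^esub> (s2 [^]\<^bsub>Q\<^esub> b) \<otimes>\<^bsub>Q\<^esub> ?u)) = inv\<^bsub>Q\<^esub> s1 \<otimes>\<^bsub>Q\<^esub> ?u"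
    using arg_cong[OF rel, of \<theta>]
    by (simp only: \<theta>1 \<theta>2 pow gens_closed m_closed nat_pow_closed one_closed simp_thms)
  then have "inv\<^bsub>Q\<^esub> s2 \<otimes>\<^bsub>Q\<^esub> (inv\<^bsub>Q\<^esub> (s1 [^]\<^bsub>Q\<^esub> a) \<otimes>\<^bsub>Q\<^esub> inv\<^bsub>Q\<^esub> (s2 [^]\<^bsub>Q\<^esub> b)) \<otimes>\<^bsub>Q\<^esub> ?u = inv\<^bsub>Q\<^esub> s1 \<otimes>\<^bsub>Q\<^esub> ?u"
    using u by (simp add: m_assoc)
  then have "inv\<^bsub>Q\<^esub> s2 \<otimes>\<^bsub>Q\<^esub> (inv\<^bsub>Q\<^esub> (s1 [^]\<^bsub>Q\<^esub> a) \<otimes>\<^bsub>Q\<^esub> inv\<^bsub>Q\<^esub> (s2 [^]\<^bsub>Q\<^esub> b)) = inv\<^bsub>Q\<^esub> s1"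
    using u by (subst (asm) right_cancel) simp_all
  then have "s2 \<otimes>\<^bsub>Q\<^esub> inv\<^bsub>Q\<^esub> s1 = inv\<^bsub>Q\<^esub> (s1 [^]\<^bsub>Q\<^esub> a) \<otimes>\<^bsub>Q\<^esub> inv\<^bsub>Q\<^esub> (s2 [^]\<^bsub>Q\<^esub> b)"
    by (metis gens_closed inv_closed inv_solve_left m_closed nat_pow_closed)
  \<comment> \<open>The image of the fourth relation is an expression for the left side of the
    fifth, so the two right sides agree.\<close>
  then have eq: "s1 [^]\<^bsub>Q\<^esub> (- 3 + A) \<otimes>\<^bsub>Q\<^esub> s2 [^]\<^bsub>Q\<^esub> (- 1 + int n) =
      inv\<^bsub>Q\<^esub> (s1 [^]\<^bsub>Q\<^esub> (3 + A)) \<otimes>\<^bsub>Q\<^esub> inv\<^bsub>Q\<^esub> (s2 [^]\<^bsub>Q\<^esub> (1 + int n))"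
    using group_relations(5) pows by simp
  \<comment> \<open>Bringing \<open>eq\<close> to one side leaves a normal form of the identity,
    with an exponent of \<open>s2\<close> that m^\<beta> does not divide.\<close>
  have "s1 [^]\<^bsub>Q\<^esub> (2 * nat A) \<otimes>\<^bsub>Q\<^esub> s2 [^]\<^bsub>Q\<^esub> (2 * n) =
      s1 [^]\<^bsub>Q\<^esub> ((3 + A) + (- 3 + A)) \<otimes>\<^bsub>Q\<^esub> s2 [^]\<^bsub>Q\<^esub> ((- 1 + int n) + (1 + int n))"
    using int_pow_int[of Q s1 "2 * nat A"] int_pow_int[of Q s2 "2 * n"] A_nonneg by simp
  also have "\<dots> = s1 [^]\<^bsub>Q\<^esub> (3 + A) \<otimes>\<^bsub>Q\<^esub> (s1 [^]\<^bsub>Q\<^esub> (- 3 + A) \<otimes>\<^bsub>Q\<^esub> s2 [^]\<^bsub>Q\<^esub> (- 1 + int n)) \<otimes>\<^bsub>Q\<^esub> s2 [^]\<^bsub>Q\<^esub> (1 + int n)"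
    by (simp only: int_pow_mult gens_closed m_assoc m_closed int_pow_closed)
  also have "\<dots> = \<one>\<^bsub>Q\<^esub>" unfolding eq by (simp add: m_assoc)
  finally show False using independent q_not_dvd by blast
qed

theorem tight_chiral:
  "is_aut_group_of_tight_chiral_polyhedron Q (pres_class R \<sigma>1) (pres_class R \<sigma>2) (2 * m ^ \<alpha>) (m ^ \<beta>)"
proof -
  have m: "3 \<le> m ^ i" if "1 \<le> i" for i
    using m_ge_3 self_le_power[of m i] that by linarith
  interpret rot: tight_rotation_group Q s1 s2 "2 * m ^ \<alpha>" "m ^ \<beta>"
    by unfold_locales
      (use group_relations normal_form independent m[of \<alpha>] m[of \<beta>] \<alpha> \<beta> in \<open>simp_all del: power_eq_0_iff\<close>)
  show ?thesis
    unfolding s1_def[symmetric] s2_def[symmetric]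
    by (rule rot.is_aut_group_of_tight_chiral_polyhedron) (rule no_inverting_map)
qed

end

section \<open>Both presentations as members of the family\<close>

theorem theorem3p9:
  fixes m \<alpha> \<beta> :: nat and k :: int
  assumes "prime m" and "odd m"
    and "1 \<le> \<alpha>" and "2 \<le> \<beta>"
    and "1 \<le> k" and "k \<le> int m - 1"
  shows "is_aut_group_of_tight_chiral_polyhedron
           (presented_group (rels_first m \<beta> k))
           (pres_class (rels_first m \<beta> k) \<sigma>1) (pres_class (rels_first m \<beta> k) \<sigma>2)
           (2 * m ^ \<beta>) (m ^ \<beta>) \<and>
         (\<beta> > \<alpha> \<longrightarrow>
         is_aut_group_of_tight_chiral_polyhedron
           (presented_group (rels_second m \<alpha> \<beta> k))
           (pres_class (rels_second m \<alpha> \<beta> k) \<sigma>1) (pres_class (rels_second m \<alpha> \<beta> k) \<sigma>2)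
           (2 * m ^ \<alpha>) (m ^ \<beta>))"
proof (intro conjI impI)
  define n where "n = nat k * m ^ (\<beta> - 1)"
  have n: "int n = k * int m ^ (\<beta> - 1)" using assms by (simp add: n_def)
  have k: "\<not> m dvd nat k" using assms by (auto dest!: dvd_imp_le)
  have m_dvd: "int m dvd int n" using assms by (simp add: n)
  have even: "2 dvd int m + 1" using assms by simp
  define A where "A = (int m + 1) * int n"
  have "2 * int m dvd A" unfolding A_def using even m_dvd by (rule mult_dvd_mono)
  moreover have "2 * int m ^ \<beta> dvd A + int n * (int m ^ \<beta> - 1)"
  proof -
    \<comment> \<open>The terms \<open>int n\<close> cancel. Of the two remaining factors the first
      is a multiple of m^\<beta> and the second is even, as a sum of two odd numbers.\<close>
    have "A + int n * (int m ^ \<beta> - 1) = (int m * int n) * (1 + int m ^ (\<beta> - 1))"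
      using assms by (cases \<beta>) (simp_all add: A_def algebra_simps)
    moreover have "int m ^ \<beta> dvd int m * int n" using assms by (cases \<beta>) (simp_all add: n)
    moreover have "2 dvd 1 + int m ^ (\<beta> - 1)" using assms by simp
    ultimately show ?thesis by (metis mult.commute mult_dvd_mono)
  qed
  ultimately interpret first: chiral_parameters m \<beta> \<beta> n "nat k" A
    using assms k by unfold_locales (simp_all add: n_def A_def)
  have "rels_first m \<beta> k = chiral_rels m \<beta> \<beta> A n"
    unfolding rels_first_def chiral_rels_def n A_def by (simp add: mult_ac)
  then show "is_aut_group_of_tight_chiral_polyhedron
      (presented_group (rels_first m \<beta> k))
      (pres_class (rels_first m \<beta> k) \<sigma>1) (pres_class (rels_first m \<beta> k) \<sigma>2)
      (2 * m ^ \<beta>) (m ^ \<beta>)"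
    using first.tight_chiral by simp
  assume "\<alpha> < \<beta>"
  have "2 * int m ^ \<alpha> dvd int n * (int m ^ \<alpha> - 1)"
  proof -
    \<comment> \<open>Here \<alpha> < \<beta> enters: m^\<alpha> divides m^(\<beta>-1), so the
      weights balance with \<open>A = 0\<close>.\<close>
    have "int m ^ \<alpha> dvd int n" unfolding n using \<open>\<alpha> < \<beta>\<close> by (intro dvd_mult le_imp_power_dvd) simp
    then have "int m ^ \<alpha> * 2 dvd int n * (int m ^ \<alpha> - 1)" using assms by (intro mult_dvd_mono) simp_all
    then show ?thesis by (simp add: mult.commute)
  qed
  then interpret second: chiral_parameters m \<alpha> \<beta> n "nat k" 0
    using assms k \<open>\<alpha> < \<beta>\<close> by unfold_locales (simp_all add: n_def)
  have "rels_second m \<alpha> \<beta> k = chiral_rels m \<alpha> \<beta> 0 n"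
    unfolding rels_second_def chiral_rels_def n by simp
  then show "is_aut_group_of_tight_chiral_polyhedron
      (presented_group (rels_second m \<alpha> \<beta> k))
      (pres_class (rels_second m \<alpha> \<beta> k) \<sigma>1) (pres_class (rels_second m \<alpha> \<beta> k) \<sigma>2)
      (2 * m ^ \<alpha>) (m ^ \<beta>)"
    using second.tight_chiral by simp
qed

end
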